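(* Let $k$ be an algebraically closed field of characteristic $0$, let $R=k\langle x,y\rangle/(xy-yx-y^2)$, and let $n\geq 1$. Among the irreducible components of the variety $\mathrm{mod}(R,n)$, only the component $K_{(n)}=\overline{\mathcal{U}_{(n)}}$, the closure of the stratum corresponding to the trivial partition $(n)$ of $n$, contains an open dense subset (of that component) consisting of indecomposable modules.
   Context: $\mathrm{mod}(R,n)$ denotes the variety of $n$-dimensional representations of $R$, i.e. the Zariski closed subset of $M_n(k)\times M_n(k)$ consisting of pairs $(X,Y)$ of $n\times n$ matrices with $XY-YX=Y^2$; a point $(X,Y)$ is identified with the $R$-module $k^n$ on which $x$, $y$ act by $X$, $Y$. For every such pair $Y$ is nilpotent. The stratum $\mathcal{U}_{(n)}$ is the set of all $(X,Y)\in \mathrm{mod}(R,n)$ such that the Jordan normal form of $Y$ is a single (nilpotent) Jordan block of size $n$; its Zariski closure $K_{(n)}$ is an irreducible component of $\mathrm{mod}(R,n)$. The assertion means that $K_{(n)}$ contains an open dense subset consisting of indecomposable modules, and no other irreducible component does. *)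

theory Defs
  imports
    "HOL-Analysis.Abstract_Topology"
    "Jordan_Normal_Form.Jordan_Normal_Form"
    "Jordan_Normal_Form.VS_Connect"
begin

section \<open>The Zariski topology on pairs of square matrices\<close>

definition matrix_pairs :: "nat \<Rightarrow> ('k mat \<times> 'k mat) set" where
  "matrix_pairs n = carrier_mat n n \<times> carrier_mat n n"

text \<open>Polynomials in the \<open>2 * n\<^sup>2\<close> matrix entries, represented by the functions they
  induce; the zero set of a polynomial depends only on this function.\<close>

inductive_set poly_functions :: "nat \<Rightarrow> ('k::field mat \<times> 'k mat \<Rightarrow> 'k) set"
  for n :: nat where
  const: "(\<lambda>_. c) \<in> poly_functions n"
| coord_fst: "i < n \<Longrightarrow> j < n \<Longrightarrow> (\<lambda>(X, Y). X $$ (i, j)) \<in> poly_functions n"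
| coord_snd: "i < n \<Longrightarrow> j < n \<Longrightarrow> (\<lambda>(X, Y). Y $$ (i, j)) \<in> poly_functions n"
| add: "f \<in> poly_functions n \<Longrightarrow> g \<in> poly_functions n \<Longrightarrow> (\<lambda>p. f p + g p) \<in> poly_functions n"
| mult: "f \<in> poly_functions n \<Longrightarrow> g \<in> poly_functions n \<Longrightarrow> (\<lambda>p. f p * g p) \<in> poly_functions n"

definition zero_locus ::
    "nat \<Rightarrow> ('k::field mat \<times> 'k mat \<Rightarrow> 'k) set \<Rightarrow> ('k mat \<times> 'k mat) set" where
  "zero_locus n F = {p \<in> matrix_pairs n. \<forall>f\<in>F. f p = 0}"

definition zariski :: "nat \<Rightarrow> ('k::field mat \<times> 'k mat) topology" where
  "zariski n = topology (\<lambda>U. U \<subseteq> matrix_pairs n \<and>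
     (\<exists>F \<subseteq> poly_functions n. matrix_pairs n - U = zero_locus n F))"

lemma istopology_zariski:
  "istopology (\<lambda>U. U \<subseteq> matrix_pairs n \<and>
     (\<exists>F \<subseteq> (poly_functions n :: ('k::field mat \<times> 'k mat \<Rightarrow> 'k) set).
        matrix_pairs n - U = zero_locus n F))"
  unfolding istopology_def
proof (rule conjI; intro allI impI)
  fix S T :: "('k mat \<times> 'k mat) set"
  assume S: "S \<subseteq> matrix_pairs n \<and> (\<exists>F \<subseteq> poly_functions n. matrix_pairs n - S = zero_locus n F)"
    and T: "T \<subseteq> matrix_pairs n \<and> (\<exists>F \<subseteq> poly_functions n. matrix_pairs n - T = zero_locus n F)"
  from S obtain F where F: "F \<subseteq> poly_functions n" "matrix_pairs n - S = zero_locus n F" by blast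
  from T obtain G where G: "G \<subseteq> poly_functions n" "matrix_pairs n - T = zero_locus n G" by blast
  let ?H = "{(\<lambda>p. f p * g p) | f g. f \<in> F \<and> g \<in> G}"
  have "?H \<subseteq> poly_functions n" using F(1) G(1) by (auto intro: poly_functions.mult)
  moreover have "zero_locus n ?H = zero_locus n F \<union> zero_locus n G"
    unfolding zero_locus_def by fastforce
  then have "matrix_pairs n - S \<inter> T = zero_locus n ?H" using F(2) G(2) by blast
  ultimately show "S \<inter> T \<subseteq> matrix_pairs n \<and>
      (\<exists>F \<subseteq> poly_functions n. matrix_pairs n - S \<inter> T = zero_locus n F)"
    using S by blast
next
  fix \<K> :: "('k mat \<times> 'k mat) set set"
  assume K: "\<forall>K\<in>\<K>. K \<subseteq> matrix_pairs n \<and>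
    (\<exists>F \<subseteq> poly_functions n. matrix_pairs n - K = zero_locus n F)"
  then obtain F where F: "\<And>K. K \<in> \<K> \<Longrightarrow> F K \<subseteq> poly_functions n"
      "\<And>K. K \<in> \<K> \<Longrightarrow> matrix_pairs n - K = zero_locus n (F K)"
    by metis
  have "matrix_pairs n - \<Union>\<K> = zero_locus n (\<Union>(F ` \<K>))"
  proof -
    have "p \<notin> \<Union>\<K> \<longleftrightarrow> (\<forall>f\<in>\<Union>(F ` \<K>). f p = 0)" if "p \<in> matrix_pairs n" for p
      using F(2) that unfolding zero_locus_def by blast
    then show ?thesis unfolding zero_locus_def by blast
  qed
  moreover have "\<Union>(F ` \<K>) \<subseteq> poly_functions n" using F(1) by blast
  ultimately show "\<Union>\<K> \<subseteq> matrix_pairs n \<and>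
      (\<exists>F \<subseteq> poly_functions n. matrix_pairs n - \<Union>\<K> = zero_locus n F)"
    using K by blast
qed

lemma openin_zariski:
  "openin (zariski n) U \<longleftrightarrow> U \<subseteq> matrix_pairs n \<and>
     (\<exists>F \<subseteq> poly_functions n. matrix_pairs n - U = zero_locus n F)"
  unfolding zariski_def by (simp add: topology_inverse'[OF istopology_zariski])

lemma topspace_zariski: "topspace (zariski n) = (matrix_pairs n :: ('k::field mat \<times> 'k mat) set)"
proof -
  have "openin (zariski n) (matrix_pairs n :: ('k mat \<times> 'k mat) set)"
    unfolding openin_zariski zero_locus_def
    by (intro conjI exI[of _ "{\<lambda>_. 1}"]) (auto intro: poly_functions.const)
  then show ?thesis
    by (metis openin_subset openin_topspace openin_zariski subset_antisym)
qed

lemma closedin_zariski: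
  "closedin (zariski n) C \<longleftrightarrow> (\<exists>F \<subseteq> poly_functions n. C = zero_locus n F)"
proof -
  have "zero_locus n F \<subseteq> matrix_pairs n" for F :: "('a mat \<times> 'a mat \<Rightarrow> 'a) set"
    by (auto simp: zero_locus_def)
  then show ?thesis
    unfolding closedin_def topspace_zariski openin_zariski by (metis Diff_subset double_diff subset_refl)
qed


section \<open>Irreducible components\<close>

definition irreducible_space :: "'a topology \<Rightarrow> bool" where
  "irreducible_space T \<longleftrightarrow> topspace T \<noteq> {} \<and>
     (\<forall>A B. closedin T A \<and> closedin T B \<and> A \<union> B = topspace T \<longrightarrow>
        A = topspace T \<or> B = topspace T)"

definition irreducible_components_of :: "'a topology \<Rightarrow> 'a set set" where
  "irreducible_components_of T =
     {C. C \<subseteq> topspace T \<and> irreducible_space (subtopology T C) \<and>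
       (\<forall>D. D \<subseteq> topspace T \<and> irreducible_space (subtopology T D) \<and> C \<subseteq> D \<longrightarrow> D = C)}"


section \<open>Modules over the Jordan plane \<open>R = k\<langle>x, y\<rangle> / (xy - yx - y\<^sup>2)\<close>\<close>

text \<open>A pair \<open>(X, Y)\<close> in \<open>mod_R n\<close> is the \<open>R\<close>-module on \<open>k\<^sup>n\<close> (\<open>carrier_vec n\<close>) where
  \<open>x\<close> and \<open>y\<close> act by \<open>X\<close> and \<open>Y\<close>. As \<open>x\<close> and \<open>y\<close> generate \<open>R\<close> as a \<open>k\<close>-algebra, its
  \<open>R\<close>-submodules are the linear subspaces stable under \<open>X\<close> and \<open>Y\<close>.\<close>

definition mod_R :: "nat \<Rightarrow> ('k::field mat \<times> 'k mat) set" where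
  "mod_R n = {(X, Y). X \<in> carrier_mat n n \<and> Y \<in> carrier_mat n n \<and> X * Y - Y * X = Y ^\<^sub>m 2}"

definition mod_R_variety :: "nat \<Rightarrow> ('k::field mat \<times> 'k mat) topology" where
  "mod_R_variety n = subtopology (zariski n) (mod_R n)"

definition R_submodule :: "nat \<Rightarrow> 'k::field mat \<times> 'k mat \<Rightarrow> 'k vec set \<Rightarrow> bool" where
  "R_submodule n M W \<longleftrightarrow> VectorSpace.subspace class_ring W (module_vec TYPE('k) n) \<and>
     (\<forall>w\<in>W. fst M *\<^sub>v w \<in> W \<and> snd M *\<^sub>v w \<in> W)"

definition R_indecomposable :: "nat \<Rightarrow> 'k::field mat \<times> 'k mat \<Rightarrow> bool" where
  "R_indecomposable n M \<longleftrightarrow> carrier_vec n \<noteq> {0\<^sub>v n :: 'k vec} \<and>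
     \<not> (\<exists>W1 W2. R_submodule n M W1 \<and> R_submodule n M W2 \<and>
          W1 \<noteq> {0\<^sub>v n} \<and> W2 \<noteq> {0\<^sub>v n} \<and>
          W1 \<inter> W2 = {0\<^sub>v n} \<and> {w1 + w2 | w1 w2. w1 \<in> W1 \<and> w2 \<in> W2} = carrier_vec n)"

text \<open>The stratum of a partition \<open>ps\<close> of \<open>n\<close>, given as the list of its parts: \<open>Y\<close> has Jordan
  normal form with nilpotent blocks of sizes \<open>ps\<close>.\<close>

definition stratum :: "nat \<Rightarrow> nat list \<Rightarrow> ('k::field mat \<times> 'k mat) set" where
  "stratum n ps = {(X, Y) \<in> mod_R n. jordan_nf Y (map (\<lambda>m. (m, 0)) ps)}"

definition stratum_closure :: "nat \<Rightarrow> nat list \<Rightarrow> ('k::field mat \<times> 'k mat) set" where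
  "stratum_closure n ps = zariski n closure_of stratum n ps"

end

theory Submission
  imports Defs "Jordan_Normal_Form.Jordan_Normal_Form_Existence" "Jordan_Normal_Form.DL_Rank"
begin

text \<open>Write a module as a pair \<open>(X, Y)\<close> with \<open>X Y = Y X + Y\<^sup>2\<close>, and call the modules whose \<open>Y\<close> has Jordan type
\<open>ps\<close> the stratum of \<open>ps\<close>.

In characteristic \<open>0\<close> the relation forces \<open>Y\<close> to be nilpotent: put \<open>Y\<close> in Jordan form and compare
traces of the diagonal blocks; a block of size \<open>m\<close> with eigenvalue \<open>a\<close> gives \<open>0 = m a\<^sup>2\<close>
(\<open>jordan_commutator_eigenvalues\<close>). So finitely many strata cover the variety. Each stratum is
irreducible (\<open>stratum_irreducible\<close>), because it consists of the points \<open>(P A P\<^sup>-\<^sup>1, P J P\<^sup>-\<^sup>1)\<close> where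
\<open>J\<close> is the fixed Jordan matrix, \<open>P\<close> is invertible, and \<open>A\<close> runs through the affine space of solutions
of \<open>A J = J A + J\<^sup>2\<close>; two such points are joined by a line in \<open>(P, A)\<close>, that is, by a rational curve
inside the stratum. Hence every irreducible component is the closure of a stratum
(\<open>irreducible_component_is_stratum_closure\<close>).

For the partition \<open>(n)\<close> the stratum is the open set \<open>Y\<^sup>n\<^sup>-\<^sup>1 \<noteq> 0\<close>, so its closure is a component
(\<open>stratum_closure_trivial_is_component\<close>), in which the stratum is open and dense. Its members are
indecomposable, because \<open>ker Y\<close> is a line and every nonzero submodule contains it
(\<open>stratum_trivial_indecomposable\<close>).

For the converse, the commutator with \<open>X\<close> sends \<open>Y\<^sup>k\<close> to \<open>k Y\<^sup>k\<^sup>+\<^sup>1\<close>, so it acts nilpotently on \<open>Y\<close>.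
Therefore \<open>Y\<close> preserves the generalised eigenspaces of \<open>X\<close>, the module is their direct sum,
and on an indecomposable module \<open>X\<close> has a single eigenvalue
(\<open>R_indecomposable_single_eigenvalue\<close>). That eigenvalue is \<open>tr X / n\<close>, so the condition says that
\<open>X - (tr X / n) 1\<close> is nilpotent, which is Zariski closed. If a component contains a dense set of
indecomposable modules, the condition holds on the whole component, in particular on the stratum of
which it is the closure. But a stratum with at least two blocks contains direct sums on which \<open>X\<close> has two
different eigenvalues, since a scalar may be added to \<open>X\<close> on one summand alone
(\<open>stratum_not_centred_nilpotent\<close>). Only \<open>(n)\<close> is left. No dimension has to be computed.\<close>

section \<open>Irreducible subsets of a topological space\<close>

lemma irreducible_subtopology_iff:
  assumes "S \<subseteq> topspace T"
  shows "irreducible_space (subtopology T S) \<longleftrightarrow>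
    S \<noteq> {} \<and> (\<forall>A B. closedin T A \<and> closedin T B \<and> S \<subseteq> A \<union> B \<longrightarrow> S \<subseteq> A \<or> S \<subseteq> B)"
proof -
  have top: "topspace (subtopology T S) = S"
    using assms by (simp add: topspace_subtopology Int_absorb1)
  have eq: "(\<forall>A B. closedin (subtopology T S) A \<and> closedin (subtopology T S) B \<and> A \<union> B = S \<longrightarrow>
        A = S \<or> B = S) \<longleftrightarrow>
     (\<forall>A B. closedin T A \<and> closedin T B \<and> S \<subseteq> A \<union> B \<longrightarrow> S \<subseteq> A \<or> S \<subseteq> B)" (is "?l \<longleftrightarrow> ?r")
  proof
    assume l: ?l
    show ?r
    proof (intro allI impI, elim conjE)
      fix A B assume "closedin T A" "closedin T B" "S \<subseteq> A \<union> B"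
      then have "closedin (subtopology T S) (A \<inter> S)" "closedin (subtopology T S) (B \<inter> S)"
        "(A \<inter> S) \<union> (B \<inter> S) = S" by (auto simp: closedin_subtopology)
      with l have "A \<inter> S = S \<or> B \<inter> S = S" by blast
      then show "S \<subseteq> A \<or> S \<subseteq> B" by blast
    qed
  next
    assume r: ?r
    show ?l
    proof (intro allI impI, elim conjE)
      fix A B assume *: "closedin (subtopology T S) A" "closedin (subtopology T S) B" "A \<union> B = S"
      then obtain A' B' where "closedin T A'" "closedin T B'" "A = A' \<inter> S" "B = B' \<inter> S"
        by (auto simp: closedin_subtopology)
      moreover from this have "S \<subseteq> A' \<union> B'" using *(3) by blast
      ultimately show "A = S \<or> B = S" using r by blast
    qed
  qed
  show ?thesis unfolding irreducible_space_def top eq ..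
qed

lemma irreducible_closure_of:
  assumes "S \<subseteq> topspace T" "irreducible_space (subtopology T S)"
  shows "irreducible_space (subtopology T (T closure_of S))"
proof -
  have sub: "S \<subseteq> T closure_of S" using assms(1) by (rule closure_of_subset)
  have S: "S \<noteq> {}" "\<And>A B. closedin T A \<Longrightarrow> closedin T B \<Longrightarrow> S \<subseteq> A \<union> B \<Longrightarrow> S \<subseteq> A \<or> S \<subseteq> B"
    using assms(2) unfolding irreducible_subtopology_iff[OF assms(1)] by auto
  show ?thesis
    unfolding irreducible_subtopology_iff[OF closure_of_subset_topspace]
  proof (intro conjI allI impI, goal_cases)
    case 1
    show ?case using S(1) sub by auto
  next
    case (2 A B)
    then have "S \<subseteq> A \<or> S \<subseteq> B" using sub by (intro S(2)) auto
    then show ?case using 2 closure_of_minimal by blast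
  qed
qed

lemma irreducible_subset_finite_Union:
  assumes "finite \<F>" "\<And>F. F \<in> \<F> \<Longrightarrow> closedin T F"
    and "S \<subseteq> topspace T" "irreducible_space (subtopology T S)" "S \<subseteq> \<Union>\<F>"
  shows "\<exists>F\<in>\<F>. S \<subseteq> F"
  using assms(1,2,5)
proof (induction rule: finite_induct)
  case empty
  with assms(3,4) show ?case by (simp add: irreducible_subtopology_iff)
next
  case (insert F \<F>)
  have "closedin T F" "closedin T (\<Union>\<F>)"
    using insert.prems(1) insert.hyps(1) by (auto intro: closedin_Union)
  then have "S \<subseteq> F \<or> S \<subseteq> \<Union>\<F>"
    using assms(3,4) insert.prems(2) unfolding irreducible_subtopology_iff[OF assms(3)] by auto
  with insert show ?case by auto
qed

text \<open>Nonempty open subsets of an irreducible set are dense: the set is covered by the complement of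
the open set together with the closure of the intersection.\<close>

lemma irreducible_subset_closure_of_open:
  assumes "D \<subseteq> topspace T" "irreducible_space (subtopology T D)"
    and "openin T W" "D \<inter> W \<noteq> {}"
  shows "D \<subseteq> T closure_of (D \<inter> W)"
proof -
  have "closedin T (topspace T - W)" using assms(3) by blast
  moreover have "closedin T (T closure_of (D \<inter> W))" by simp
  moreover have "D \<inter> W \<subseteq> T closure_of (D \<inter> W)"
    using assms(1) by (intro closure_of_subset) blast
  then have "D \<subseteq> (topspace T - W) \<union> T closure_of (D \<inter> W)" using assms(1) by blast
  ultimately have "D \<subseteq> topspace T - W \<or> D \<subseteq> T closure_of (D \<inter> W)"
    using assms(2) unfolding irreducible_subtopology_iff[OF assms(1)] by blast
  with assms(4) show ?thesis by blast
qed

section \<open>Regular functions on pairs of matrices\<close>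

text \<open>Matrix operations on pairs outside \<open>matrix_pairs n\<close> involve entries out of range, and the functions
built from them are polynomial only on \<open>matrix_pairs n\<close>. The notion therefore ignores the values
elsewhere, which have no influence on zero loci.\<close>

definition regular_function :: "nat \<Rightarrow> ('k::field mat \<times> 'k mat \<Rightarrow> 'k) \<Rightarrow> bool" where
  "regular_function n f \<longleftrightarrow> (\<exists>g\<in>poly_functions n. \<forall>p\<in>matrix_pairs n. f p = g p)"

lemma regular_function_const: "regular_function n (\<lambda>_. c)"
  unfolding regular_function_def by (auto intro: poly_functions.const)

lemma regular_function_add:
  assumes "regular_function n f" "regular_function n g"
  shows "regular_function n (\<lambda>p. f p + g p)"
proof -
  from assms obtain f' g' where "f' \<in> poly_functions n" "g' \<in> poly_functions n"
    "\<And>p. p \<in> matrix_pairs n \<Longrightarrow> f p = f' p" "\<And>p. p \<in> matrix_pairs n \<Longrightarrow> g p = g' p"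
    unfolding regular_function_def by blast
  then show ?thesis unfolding regular_function_def
    by (intro bexI[of _ "\<lambda>p. f' p + g' p"] poly_functions.add) auto
qed

lemma regular_function_mult:
  assumes "regular_function n f" "regular_function n g"
  shows "regular_function n (\<lambda>p. f p * g p)"
proof -
  from assms obtain f' g' where "f' \<in> poly_functions n" "g' \<in> poly_functions n"
    "\<And>p. p \<in> matrix_pairs n \<Longrightarrow> f p = f' p" "\<And>p. p \<in> matrix_pairs n \<Longrightarrow> g p = g' p"
    unfolding regular_function_def by blast
  then show ?thesis unfolding regular_function_def
    by (intro bexI[of _ "\<lambda>p. f' p * g' p"] poly_functions.mult) auto
qed

lemma regular_function_diff:
  assumes "regular_function n f" "regular_function n g"
  shows "regular_function n (\<lambda>p. f p - g p)"
  using regular_function_add[OF assms(1) regular_function_mult[OF regular_function_const[of n "-1"] assms(2)]]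
  by simp

lemma regular_function_sum:
  assumes "\<And>i. i \<in> I \<Longrightarrow> regular_function n (f i)"
  shows "regular_function n (\<lambda>p. \<Sum>i\<in>I. f i p)"
  using assms
  by (induction I rule: infinite_finite_induct)
    (auto intro: regular_function_const regular_function_add)

lemma regular_function_cong:
  assumes "regular_function n f" "\<And>p. p \<in> matrix_pairs n \<Longrightarrow> g p = f p"
  shows "regular_function n g"
  using assms unfolding regular_function_def by auto

definition regular_matrix :: "nat \<Rightarrow> ('k::field mat \<times> 'k mat \<Rightarrow> 'k mat) \<Rightarrow> bool" where
  "regular_matrix n F \<longleftrightarrow> (\<forall>p\<in>matrix_pairs n. F p \<in> carrier_mat n n) \<and>
     (\<forall>i<n. \<forall>j<n. regular_function n (\<lambda>p. F p $$ (i, j)))"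

lemma regular_matrix_fst: "regular_matrix n fst"
proof -
  have "regular_function n (\<lambda>p. fst p $$ (i, j))" if "i < n" "j < n" for i j
    using poly_functions.coord_fst[OF that] unfolding regular_function_def
    by (rule rev_bexI) (simp add: case_prod_beta)
  then show ?thesis by (auto simp: regular_matrix_def matrix_pairs_def)
qed

lemma regular_matrix_snd: "regular_matrix n snd"
proof -
  have "regular_function n (\<lambda>p. snd p $$ (i, j))" if "i < n" "j < n" for i j
    using poly_functions.coord_snd[OF that] unfolding regular_function_def
    by (rule rev_bexI) (simp add: case_prod_beta)
  then show ?thesis by (auto simp: regular_matrix_def matrix_pairs_def)
qed

lemma regular_matrix_smult_one:
  assumes "regular_function n f"
  shows "regular_matrix n (\<lambda>p. f p \<cdot>\<^sub>m 1\<^sub>m n)"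
  unfolding regular_matrix_def
proof (intro conjI ballI allI impI)
  fix i j assume ij: "i < n" "j < n"
  have "regular_function n (\<lambda>p. f p * (if i = j then 1 else 0))"
    by (intro regular_function_mult assms regular_function_const)
  then show "regular_function n (\<lambda>p. (f p \<cdot>\<^sub>m 1\<^sub>m n) $$ (i, j))"
    by (rule regular_function_cong) (use ij in auto)
qed auto

lemma regular_matrix_diff:
  assumes "regular_matrix n F" "regular_matrix n G"
  shows "regular_matrix n (\<lambda>p. F p - G p)"
  unfolding regular_matrix_def
proof (intro conjI ballI allI impI)
  fix i j assume ij: "i < n" "j < n"
  have "regular_function n (\<lambda>p. F p $$ (i, j) - G p $$ (i, j))"
    using assms ij by (intro regular_function_diff) (auto simp: regular_matrix_def)
  moreover have "(F p - G p) $$ (i, j) = F p $$ (i, j) - G p $$ (i, j)" if "p \<in> matrix_pairs n" for p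
    using assms(2) ij that by (auto simp: regular_matrix_def)
  ultimately show "regular_function n (\<lambda>p. (F p - G p) $$ (i, j))" by (rule regular_function_cong)
qed (use assms in \<open>auto simp: regular_matrix_def intro!: minus_carrier_mat\<close>)

lemma regular_matrix_mult:
  assumes "regular_matrix n F" "regular_matrix n G"
  shows "regular_matrix n (\<lambda>p. F p * G p)"
  unfolding regular_matrix_def
proof (intro conjI ballI allI impI)
  fix i j assume ij: "i < n" "j < n"
  have "regular_function n (\<lambda>p. \<Sum>k\<in>{0..<n}. F p $$ (i, k) * G p $$ (k, j))"
    using assms ij
    by (intro regular_function_sum regular_function_mult) (auto simp: regular_matrix_def)
  moreover have "(F p * G p) $$ (i, j) = (\<Sum>k\<in>{0..<n}. F p $$ (i, k) * G p $$ (k, j))"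
    if "p \<in> matrix_pairs n" for p
  proof -
    have "F p \<in> carrier_mat n n" "G p \<in> carrier_mat n n"
      using assms that by (auto simp: regular_matrix_def)
    then show ?thesis using ij by (simp add: scalar_prod_def)
  qed
  ultimately show "regular_function n (\<lambda>p. (F p * G p) $$ (i, j))" by (rule regular_function_cong)
qed (use assms in \<open>auto simp: regular_matrix_def intro!: mult_carrier_mat\<close>)

lemma regular_matrix_cong:
  assumes "regular_matrix n F" "\<And>p. p \<in> matrix_pairs n \<Longrightarrow> G p = F p"
  shows "regular_matrix n G"
  unfolding regular_matrix_def
proof (intro conjI ballI allI impI)
  fix i j assume "i < n" "j < n"
  then have "regular_function n (\<lambda>p. F p $$ (i, j))" using assms(1) by (simp add: regular_matrix_def)
  then show "regular_function n (\<lambda>p. G p $$ (i, j))"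
    by (rule regular_function_cong) (simp add: assms(2))
qed (use assms in \<open>auto simp: regular_matrix_def\<close>)

lemma regular_matrix_pow:
  assumes "regular_matrix n F"
  shows "regular_matrix n (\<lambda>p. F p ^\<^sub>m k)"
proof (induction k)
  case 0
  have "regular_matrix n (\<lambda>_. 1 \<cdot>\<^sub>m 1\<^sub>m n)"
    by (intro regular_matrix_smult_one regular_function_const)
  moreover have "F p ^\<^sub>m 0 = 1 \<cdot>\<^sub>m 1\<^sub>m n" if "p \<in> matrix_pairs n" for p
  proof -
    have "F p \<in> carrier_mat n n" using assms that by (simp add: regular_matrix_def)
    then show ?thesis by (intro eq_matI) auto
  qed
  ultimately show ?case by (rule regular_matrix_cong)
next
  case (Suc k)
  then show ?case using assms by (simp add: regular_matrix_mult)
qed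

lemma closedin_zariski_regular:
  assumes "\<And>f. f \<in> F \<Longrightarrow> regular_function n f"
  shows "closedin (zariski n) {p \<in> matrix_pairs n. \<forall>f\<in>F. f p = 0}"
proof -
  from assms obtain G where G: "\<And>f. f \<in> F \<Longrightarrow> G f \<in> poly_functions n"
    "\<And>f p. f \<in> F \<Longrightarrow> p \<in> matrix_pairs n \<Longrightarrow> f p = G f p"
    unfolding regular_function_def by metis
  have "{p \<in> matrix_pairs n. \<forall>f\<in>F. f p = 0} = zero_locus n (G ` F)"
    using G(2) by (auto simp: zero_locus_def)
  moreover have "G ` F \<subseteq> poly_functions n" using G(1) by auto
  ultimately show ?thesis unfolding closedin_zariski by (intro exI[of _ "G ` F"]) simp
qed

lemma closedin_zariski_matrix_eq_0:
  assumes "regular_matrix n F"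
  shows "closedin (zariski n) {p \<in> matrix_pairs n. F p = 0\<^sub>m n n}"
proof -
  let ?F = "{(\<lambda>p. F p $$ (i, j)) | i j. i < n \<and> j < n}"
  have "{p \<in> matrix_pairs n. F p = 0\<^sub>m n n} = {p \<in> matrix_pairs n. \<forall>f\<in>?F. f p = 0}"
    (is "?A = ?B")
  proof (rule Collect_cong, rule conj_cong[OF refl])
    fix p :: "'a mat \<times> 'a mat" assume "p \<in> matrix_pairs n"
    with assms have "F p \<in> carrier_mat n n" by (simp add: regular_matrix_def)
    then have "F p = 0\<^sub>m n n \<longleftrightarrow> (\<forall>i<n. \<forall>j<n. F p $$ (i, j) = 0)"
      unfolding mat_eq_iff by simp
    then show "F p = 0\<^sub>m n n \<longleftrightarrow> (\<forall>f\<in>?F. f p = 0)" by auto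
  qed
  also have "closedin (zariski n) \<dots>"
    using assms by (intro closedin_zariski_regular) (auto simp: regular_matrix_def)
  finally show ?thesis .
qed

section \<open>Jordan form over an algebraically closed field\<close>

lemma inverse_via_adjugate:
  fixes P :: "'a::field mat"
  assumes P: "P \<in> carrier_mat n n" and "det P \<noteq> 0"
  defines "Q \<equiv> inverse (det P) \<cdot>\<^sub>m adj_mat P"
  shows "Q \<in> carrier_mat n n" "P * Q = 1\<^sub>m n" "Q * P = 1\<^sub>m n"
proof -
  note adj = adj_mat[OF P]
  have s: "inverse (det P) \<cdot>\<^sub>m (det P \<cdot>\<^sub>m 1\<^sub>m n) = 1\<^sub>m n"
    using assms(2) by (intro eq_matI) auto
  show "Q \<in> carrier_mat n n" unfolding Q_def using adj(1) by simp
  show "P * Q = 1\<^sub>m n" unfolding Q_def mult_smult_distrib[OF P adj(1)] adj(2) by (rule s)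
  show "Q * P = 1\<^sub>m n" unfolding Q_def mult_smult_assoc_mat[OF adj(1) P] adj(3) by (rule s)
qed

lemma invertible_with_first_column:
  fixes v :: "'a::field vec"
  assumes v: "v \<in> carrier_vec n" "v \<noteq> 0\<^sub>v n"
  obtains P Q where "P \<in> carrier_mat n n" "Q \<in> carrier_mat n n" "P * Q = 1\<^sub>m n" "Q * P = 1\<^sub>m n"
    "col P 0 = v"
proof -
  interpret vec_space "TYPE('a)" n .
  let ?b = "basis_completion v"
  note b = basis_completion[OF v]
  define P where "P = mat_of_cols n ?b"
  have P: "P \<in> carrier_mat n n" unfolding P_def using b(6) mat_of_cols_carrier(1)[of n ?b] by simp
  have cols: "cols P = ?b" unfolding P_def using b(2) by simp
  have "rank P = n" using b(4,5) by (intro lin_indpt_full_rank[OF P]) (simp_all add: cols)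
  then have det: "det P \<noteq> 0" using det_rank_iff[OF P] by simp
  have "n \<noteq> 0"
  proof
    assume "n = 0"
    then have "v = 0\<^sub>v n" using v(1) by (intro eq_vecI) auto
    with v(2) show False by simp
  qed
  then have ne: "?b \<noteq> []" using b(6) by auto
  then have "col P 0 = v"
    using b(2,7) ne v(1) unfolding P_def by (subst col_mat_of_cols) (auto simp: hd_conv_nth)
  with inverse_via_adjugate[OF P det] P show thesis using that by blast
qed

lemma eigenvalue_exists:
  fixes A :: "'a::alg_closed_field mat"
  assumes A: "A \<in> carrier_mat n n" and "n > 0"
  shows "\<exists>e. eigenvalue A e"
proof -
  have "degree (char_poly A) > 0" using degree_monic_char_poly[OF A] assms(2) by simp
  from alg_closed_imp_poly_has_root[OF this] show ?thesis
    using eigenvalue_root_char_poly[OF A] by auto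
qed

text \<open>Induction on the size: change to a basis that starts with an eigenvector, then triangularise the
lower right block. The argument uses no inner product and so works over any algebraically
closed field.\<close>

lemma triangularizable:
  fixes A :: "'a::alg_closed_field mat"
  assumes "A \<in> carrier_mat n n"
  shows "\<exists>B\<in>carrier_mat n n. upper_triangular B \<and> similar_mat A B"
  using assms
proof (induction n arbitrary: A)
  case 0
  then show ?case using similar_mat_refl[of A 0] by (intro bexI[of _ A]) auto
next
  case (Suc m)
  let ?n = "Suc m"
  note A = Suc.prems
  obtain e v where "eigenvector A v e"
    using eigenvalue_exists[OF A] unfolding eigenvalue_def by auto
  then have v: "v \<in> carrier_vec ?n" "v \<noteq> 0\<^sub>v ?n" and Av: "A *\<^sub>v v = e \<cdot>\<^sub>v v"
    using A unfolding eigenvector_def by auto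
  obtain P Q where P: "P \<in> carrier_mat ?n ?n" and Q: "Q \<in> carrier_mat ?n ?n"
    and PQ: "P * Q = 1\<^sub>m ?n" and QP: "Q * P = 1\<^sub>m ?n" and c: "col P 0 = v"
    using invertible_with_first_column[OF v] by blast
  define A' where "A' = Q * A * P"
  have A': "A' \<in> carrier_mat ?n ?n" unfolding A'_def using A P Q by simp
  have "P * A' * Q = (P * Q) * A * (P * Q)" unfolding A'_def using A P Q
    by (simp add: assoc_mult_mat[of _ ?n ?n _ ?n _ ?n])
  then have "A = P * A' * Q" using A by (simp add: PQ)
  then have sim: "similar_mat A A'"
    using A A' P Q PQ QP by (intro similar_matI[of A A' P Q ?n]) auto
  have "col (Q * P) 0 = Q *\<^sub>v col P 0" by (rule col_mult2[OF Q P]) simp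
  then have Qv: "Q *\<^sub>v v = unit_vec ?n 0" unfolding QP c by simp
  have "col A' 0 = (Q * A) *\<^sub>v v"
    unfolding A'_def using P Q A c by (subst col_mult2[of _ ?n ?n _ ?n]) auto
  also have "\<dots> = Q *\<^sub>v (A *\<^sub>v v)" using A Q v by (simp add: assoc_mult_mat_vec[of _ ?n ?n _ ?n])
  also have "\<dots> = e \<cdot>\<^sub>v unit_vec ?n 0" unfolding Av using mult_mat_vec[OF Q v(1)] Qv by simp
  finally have col0: "col A' 0 = e \<cdot>\<^sub>v unit_vec ?n 0" .
  obtain A1 A2 A3 A4 where spl: "split_block A' 1 1 = (A1, A2, A3, A4)" by (metis prod_cases4)
  have dims: "dim_row A' = 1 + m" "dim_col A' = 1 + m" using A' by auto
  note blk = split_block[OF spl dims]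
  have "A3 = 0\<^sub>m m 1"
  proof (rule eq_matI)
    fix i j assume ij: "i < dim_row (0\<^sub>m m 1)" "j < dim_col (0\<^sub>m m 1)"
    then have "A3 $$ (i, j) = A' $$ (Suc i, 0)" using blk(1-4) unfolding blk(5) by auto
    also have "\<dots> = col A' 0 $ Suc i" using A' ij by simp
    also have "\<dots> = 0" unfolding col0 using ij by simp
    finally show "A3 $$ (i, j) = 0\<^sub>m m 1 $$ (i, j)" using ij by simp
  qed (use blk(3) in auto)
  with blk have A'_eq: "A' = four_block_mat A1 A2 (0\<^sub>m m 1) A4" by simp
  obtain B4 where B4: "B4 \<in> carrier_mat m m" "upper_triangular B4" "similar_mat A4 B4"
    using Suc.IH[OF blk(4)] by blast
  obtain B0 where "similar_mat A' (four_block_mat A1 B0 (0\<^sub>m m 1) B4)"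
    using similar_mat_four_block_0_ex[OF similar_mat_refl[OF blk(1)] B4(3) blk(2,1,4)]
    unfolding A'_eq by blast
  with sim have "similar_mat A (four_block_mat A1 B0 (0\<^sub>m m 1) B4)" by (rule similar_mat_trans)
  moreover have "upper_triangular A1" using blk(1) by (intro upper_triangularI) auto
  then have "upper_triangular (four_block_mat A1 B0 (0\<^sub>m m 1) B4)"
    using blk(1) B4 by (intro upper_triangular_four_block) auto
  moreover have "four_block_mat A1 B0 (0\<^sub>m m 1) B4 \<in> carrier_mat ?n ?n"
    using four_block_carrier_mat[OF blk(1) B4(1)] by simp
  ultimately show ?case by blast
qed

lemma jordan_nf_exists_alg_closed:
  fixes A :: "'a::alg_closed_field mat"
  assumes "A \<in> carrier_mat n n"
  shows "\<exists>n_as. jordan_nf A n_as"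
proof -
  obtain B where "B \<in> carrier_mat n n" "upper_triangular B" "similar_mat A B"
    using triangularizable[OF assms] by blast
  then show ?thesis
    using triangular_to_jnf_vector[of B n] similar_mat_trans unfolding jordan_nf_def by blast
qed

lemma jordan_matrix_Cons:
  "jordan_matrix ((m, a) # n_as) = four_block_mat (jordan_block m a)
     (0\<^sub>m m (sum_list (map fst n_as))) (0\<^sub>m (sum_list (map fst n_as)) m) (jordan_matrix n_as)"
proof -
  have "diag_block_mat (map (\<lambda>(n, a). jordan_block n a) n_as) = jordan_matrix n_as"
    by (simp add: jordan_matrix_def)
  then show ?thesis
    using jordan_matrix_dim[of n_as] unfolding jordan_matrix_def[of "(m, a) # n_as"]
    by (simp add: Let_def)
qed

lemma four_block_mat_inject:
  assumes "A \<in> carrier_mat n n" "A' \<in> carrier_mat n n" "D \<in> carrier_mat m m" "D' \<in> carrier_mat m m"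
    and eq: "four_block_mat A B C D = four_block_mat A' B' C' D'"
  shows "A = A'" "D = D'"
proof -
  have eq': "four_block_mat A B C D $$ (i, j) = four_block_mat A' B' C' D' $$ (i, j)" for i j
    by (simp add: eq)
  show "A = A'"
  proof (rule eq_matI)
    fix i j assume "i < dim_row A'" "j < dim_col A'"
    then show "A $$ (i, j) = A' $$ (i, j)" using eq'[of i j] assms(1-4) by simp
  qed (use assms in auto)
  show "D = D'"
  proof (rule eq_matI)
    fix i j assume "i < dim_row D'" "j < dim_col D'"
    then show "D $$ (i, j) = D' $$ (i, j)" using eq'[of "n + i" "n + j"] assms(1-4) by simp
  qed (use assms in auto)
qed

section \<open>The relation forces nilpotency\<close>

definition mat_trace :: "'a::comm_ring_1 mat \<Rightarrow> 'a" where
  "mat_trace A = (\<Sum>i<dim_row A. A $$ (i, i))"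

lemma mat_trace_mult_comm:
  assumes A: "A \<in> carrier_mat n m" and B: "B \<in> carrier_mat m n"
  shows "mat_trace (A * B) = mat_trace (B * A)"
proof -
  have "mat_trace (A * B) = (\<Sum>i<n. \<Sum>k<m. A $$ (i, k) * B $$ (k, i))"
    unfolding mat_trace_def using A B by (auto simp: scalar_prod_def atLeast0LessThan intro!: sum.cong)
  also have "\<dots> = (\<Sum>k<m. \<Sum>i<n. B $$ (k, i) * A $$ (i, k))"
    by (subst sum.swap) (simp add: mult.commute)
  also have "\<dots> = mat_trace (B * A)"
    unfolding mat_trace_def using A B by (auto simp: scalar_prod_def atLeast0LessThan intro!: sum.cong)
  finally show ?thesis .
qed

lemma mat_trace_four_block:
  assumes "A \<in> carrier_mat n n" "D \<in> carrier_mat m m"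
  shows "mat_trace (four_block_mat A B C D) = mat_trace A + mat_trace D"
proof -
  have "mat_trace (four_block_mat A B C D) =
      (\<Sum>i<n. A $$ (i, i)) + (\<Sum>i\<in>{n..<n+m}. D $$ (i - n, i - n))"
  proof -
    have split: "{..<n + m} = {..<n} \<union> {n..<n + m}" by auto
    have "(\<Sum>i\<in>{..<n} \<union> {n..<n + m}. four_block_mat A B C D $$ (i, i)) =
        (\<Sum>i<n. four_block_mat A B C D $$ (i, i)) + (\<Sum>i\<in>{n..<n + m}. four_block_mat A B C D $$ (i, i))"
      by (rule sum.union_disjoint) auto
    also have "\<dots> = (\<Sum>i<n. A $$ (i, i)) + (\<Sum>i\<in>{n..<n + m}. D $$ (i - n, i - n))"
      using assms by (intro arg_cong2[of _ _ _ _ "(+)"] sum.cong) auto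
    finally show ?thesis using assms by (simp add: mat_trace_def split)
  qed
  also have "(\<Sum>i\<in>{n..<n+m}. D $$ (i - n, i - n)) = (\<Sum>i<m. D $$ (i, i))"
    by (rule sum.reindex_bij_witness[of _ "\<lambda>i. n + i" "\<lambda>i. i - n"]) auto
  finally show ?thesis using assms by (simp add: mat_trace_def)
qed

lemma mat_trace_jordan_matrix:
  "mat_trace (jordan_matrix n_as) = (\<Sum>(m, a)\<leftarrow>n_as. of_nat m * a)"
proof (induction n_as)
  case Nil
  then show ?case by (simp add: mat_trace_def)
next
  case (Cons p n_as)
  obtain m a where p: "p = (m, a)" by force
  have "mat_trace (jordan_block m a) = of_nat m * a" by (simp add: mat_trace_def)
  then show ?case unfolding p jordan_matrix_Cons
    by (subst mat_trace_four_block[OF jordan_block_carrier jordan_matrix_carrier]) (simp add: Cons)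
qed

lemma four_block_mult_diag:
  fixes B :: "'a::comm_ring_1 mat"
  assumes X: "X1 \<in> carrier_mat n n" "X2 \<in> carrier_mat n m" "X3 \<in> carrier_mat m n" "X4 \<in> carrier_mat m m"
    and B: "B \<in> carrier_mat n n" and D: "D \<in> carrier_mat m m"
  shows "four_block_mat X1 X2 X3 X4 * four_block_mat B (0\<^sub>m n m) (0\<^sub>m m n) D =
      four_block_mat (X1 * B) (X2 * D) (X3 * B) (X4 * D)"
    "four_block_mat B (0\<^sub>m n m) (0\<^sub>m m n) D * four_block_mat X1 X2 X3 X4 =
      four_block_mat (B * X1) (B * X2) (D * X3) (D * X4)"
proof -
  note z = zero_carrier_mat
  have z1: "X2 * 0\<^sub>m m n = 0\<^sub>m n n" "X1 * 0\<^sub>m n m = 0\<^sub>m n m" "X4 * 0\<^sub>m m n = 0\<^sub>m m n" "X3 * 0\<^sub>m n m = 0\<^sub>m m m"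
    and z2: "0\<^sub>m n m * X3 = 0\<^sub>m n n" "0\<^sub>m n m * X4 = 0\<^sub>m n m" "0\<^sub>m m n * X1 = 0\<^sub>m m n" "0\<^sub>m m n * X2 = 0\<^sub>m m m"
    using X by auto
  have c: "X1 * B \<in> carrier_mat n n" "X2 * D \<in> carrier_mat n m" "X3 * B \<in> carrier_mat m n" "X4 * D \<in> carrier_mat m m"
    "B * X1 \<in> carrier_mat n n" "B * X2 \<in> carrier_mat n m" "D * X3 \<in> carrier_mat m n" "D * X4 \<in> carrier_mat m m"
    using X B D by auto
  show "four_block_mat X1 X2 X3 X4 * four_block_mat B (0\<^sub>m n m) (0\<^sub>m m n) D =
      four_block_mat (X1 * B) (X2 * D) (X3 * B) (X4 * D)"
    using c by (subst mult_four_block_mat[OF X B z z D]) (simp add: z1)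
  show "four_block_mat B (0\<^sub>m n m) (0\<^sub>m m n) D * four_block_mat X1 X2 X3 X4 =
      four_block_mat (B * X1) (B * X2) (D * X3) (D * X4)"
    using c by (subst mult_four_block_mat[OF B z z D X]) (simp add: z2)
qed

text \<open>The off-diagonal blocks of \<open>X\<close> do not enter the diagonal blocks of \<open>X J - J X\<close>, because \<open>J\<close> is
block diagonal. Hence the relation restricts to each Jordan block \<open>B\<close>, where taking traces leaves
\<open>0 = tr (B\<^sup>2) = m a\<^sup>2\<close>, and \<open>m\<close> is invertible in characteristic \<open>0\<close>.\<close>

lemma jordan_commutator_eigenvalues:
  fixes n_as :: "(nat \<times> 'a::field_char_0) list"
  defines "J \<equiv> jordan_matrix n_as"
  assumes "X \<in> carrier_mat (sum_list (map fst n_as)) (sum_list (map fst n_as))"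
    and "X * J = J * X + J * J"
    and "(m, a) \<in> set n_as" "m > 0"
  shows "a = 0"
  using assms(2-) unfolding J_def
proof (induction n_as arbitrary: X)
  case Nil
  then show ?case by simp
next
  case (Cons p n_as)
  obtain m1 a1 where p: "p = (m1, a1)" by force
  let ?N = "sum_list (map fst n_as)"
  let ?B = "jordan_block m1 a1" and ?J = "jordan_matrix n_as"
  have B: "?B \<in> carrier_mat m1 m1" and J: "?J \<in> carrier_mat ?N ?N" by auto
  obtain X1 X2 X3 X4 where spl: "split_block X m1 m1 = (X1, X2, X3, X4)" by (metis prod_cases4)
  have "X \<in> carrier_mat (m1 + ?N) (m1 + ?N)" using Cons.prems(1) by (simp add: p)
  then have dims: "dim_row X = m1 + ?N" "dim_col X = m1 + ?N" by auto
  note X = split_block[OF spl dims]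
  define E where "E = four_block_mat ?B (0\<^sub>m m1 ?N) (0\<^sub>m ?N m1) ?J"
  have "X * E = E * X + E * E"
    using Cons.prems(2) unfolding p jordan_matrix_Cons E_def .
  moreover have "X * E = four_block_mat (X1 * ?B) (X2 * ?J) (X3 * ?B) (X4 * ?J)"
    unfolding X(5) E_def by (rule four_block_mult_diag(1)[OF X(1-4) B J])
  moreover have "E * X = four_block_mat (?B * X1) (?B * X2) (?J * X3) (?J * X4)"
    unfolding X(5) E_def by (rule four_block_mult_diag(2)[OF X(1-4) B J])
  moreover have "E * E = four_block_mat (?B * ?B) (0\<^sub>m m1 ?N * ?J) (0\<^sub>m ?N m1 * ?B) (?J * ?J)"
    unfolding E_def by (rule four_block_mult_diag(1)[OF B zero_carrier_mat zero_carrier_mat J B J])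
  moreover have "four_block_mat (?B * X1) (?B * X2) (?J * X3) (?J * X4) +
      four_block_mat (?B * ?B) (0\<^sub>m m1 ?N * ?J) (0\<^sub>m ?N m1 * ?B) (?J * ?J) =
      four_block_mat (?B * X1 + ?B * ?B) (?B * X2 + 0\<^sub>m m1 ?N * ?J)
        (?J * X3 + 0\<^sub>m ?N m1 * ?B) (?J * X4 + ?J * ?J)"
    by (rule add_four_block_mat[of _ m1 m1 _ ?N _ ?N];
        (rule mult_carrier_mat[OF B] mult_carrier_mat[OF J] mult_carrier_mat[OF zero_carrier_mat]); fact X B J)
  ultimately have "four_block_mat (X1 * ?B) (X2 * ?J) (X3 * ?B) (X4 * ?J) =
    four_block_mat (?B * X1 + ?B * ?B) (?B * X2 + 0\<^sub>m m1 ?N * ?J)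
        (?J * X3 + 0\<^sub>m ?N m1 * ?B) (?J * X4 + ?J * ?J)" by simp
  note inj = four_block_mat_inject[OF _ _ _ _ this, of m1 ?N]
  have e1: "X1 * ?B = ?B * X1 + ?B * ?B" using X B J by (intro inj) auto
  have e4: "X4 * ?J = ?J * X4 + ?J * ?J" using X B J by (intro inj(2)) auto
  have "mat_trace (X1 * ?B) = mat_trace (?B * X1) + mat_trace (?B * ?B)"
    unfolding e1 using X B by (auto simp: mat_trace_def sum.distrib)
  then have "mat_trace (?B * ?B) = 0" using mat_trace_mult_comm[OF X(1) B] by simp
  moreover have "(?B * ?B) $$ (i, i) = a1 * a1" if "i < m1" for i
  proof -
    have "?B ^\<^sub>m 2 = ?B * ?B" by (simp add: numeral_2_eq_2)
    then have "(?B * ?B) $$ (i, i) = (?B ^\<^sub>m 2) $$ (i, i)" by simp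
    also have "\<dots> = a1 * a1" unfolding jordan_block_pow using that by (simp add: power2_eq_square)
    finally show ?thesis .
  qed
  then have "mat_trace (?B * ?B) = of_nat m1 * (a1 * a1)" by (simp add: mat_trace_def)
  ultimately have "m1 > 0 \<Longrightarrow> a1 = 0" by simp
  then show ?case using Cons.IH[OF X(4) e4] Cons.prems(3,4) by (auto simp: p)
qed

lemma mat_diff_eq_iff:
  fixes A :: "'a::ab_group_add mat"
  assumes "A \<in> carrier_mat n m" "B \<in> carrier_mat n m" "C \<in> carrier_mat n m"
  shows "A - B = C \<longleftrightarrow> A = B + C"
  using assms by (auto simp: mat_eq_iff algebra_simps)

text \<open>The relation without subtraction is easier to transport through conjugation and block sums.\<close>

lemma mod_R_iff:
  "(X, Y) \<in> mod_R n \<longleftrightarrow>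
    X \<in> carrier_mat n n \<and> Y \<in> carrier_mat n n \<and> X * Y = Y * X + Y * Y"
proof -
  have "X * Y - Y * X = Y ^\<^sub>m 2 \<longleftrightarrow> X * Y = Y * X + Y * Y"
    if X: "X \<in> carrier_mat n n" and Y: "Y \<in> carrier_mat n n"
  proof -
    have "Y ^\<^sub>m 2 = Y * Y" using Y by (simp add: numeral_2_eq_2)
    then show ?thesis
      using mat_diff_eq_iff[OF mult_carrier_mat[OF X Y] mult_carrier_mat[OF Y X] mult_carrier_mat[OF Y Y]]
      by simp
  qed
  then show ?thesis by (auto simp: mod_R_def)
qed

lemma conjugate_mult:
  fixes M :: "'a::comm_ring_1 mat"
  assumes "P \<in> carrier_mat n n" "Q \<in> carrier_mat n n" "Q * P = 1\<^sub>m n"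
    and "M \<in> carrier_mat n n" "N \<in> carrier_mat n n"
  shows "(P * M * Q) * (P * N * Q) = P * (M * N) * Q"
proof -
  have "(P * M * Q) * (P * N * Q) = P * M * (Q * P) * N * Q"
    using assms(1,2,4,5) by (simp add: assoc_mult_mat[of _ n n _ n _ n])
  then show ?thesis unfolding assms(3)
    using assms(1,2,4,5) by (simp add: assoc_mult_mat[of _ n n _ n _ n])
qed

lemma conjugate_add:
  fixes M :: "'a::comm_ring_1 mat"
  assumes "P \<in> carrier_mat n n" "Q \<in> carrier_mat n n" "M \<in> carrier_mat n n" "N \<in> carrier_mat n n"
  shows "P * (M + N) * Q = P * M * Q + P * N * Q"
  using assms
  by (simp add: mult_add_distrib_mat[of _ n n] add_mult_distrib_mat[of _ n n])

lemma conjugate_inverse: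
  fixes M :: "'a::comm_ring_1 mat"
  assumes "P \<in> carrier_mat n n" "Q \<in> carrier_mat n n" "P * Q = 1\<^sub>m n" "M \<in> carrier_mat n n"
  shows "P * (Q * M * P) * Q = M"
proof -
  have "P * (Q * M * P) * Q = (P * Q) * M * (P * Q)"
    using assms(1,2,4) by (simp add: assoc_mult_mat[of _ n n _ n _ n])
  then show ?thesis unfolding assms(3) using assms(4) by simp
qed

lemma mod_R_conjugate:
  assumes XY: "(X, Y) \<in> mod_R n"
    and P: "P \<in> carrier_mat n n" and Q: "Q \<in> carrier_mat n n" and QP: "Q * P = 1\<^sub>m n"
  shows "(P * X * Q, P * Y * Q) \<in> mod_R n"
proof -
  have X: "X \<in> carrier_mat n n" and Y: "Y \<in> carrier_mat n n" and e: "X * Y = Y * X + Y * Y"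
    using XY by (auto simp: mod_R_iff)
  have "P * (X * Y) * Q = P * (Y * X) * Q + P * (Y * Y) * Q"
    unfolding e using P Q X Y by (intro conjugate_add) auto
  then show ?thesis
    unfolding mod_R_iff conjugate_mult[OF P Q QP X Y] conjugate_mult[OF P Q QP Y X]
      conjugate_mult[OF P Q QP Y Y] using X Y P Q by simp
qed

lemma jordan_nf_obtain:
  fixes A :: "'a::comm_ring_1 mat"
  assumes A: "A \<in> carrier_mat n n" and "jordan_nf A n_as"
  obtains P Q where "P \<in> carrier_mat n n" "Q \<in> carrier_mat n n" "P * Q = 1\<^sub>m n" "Q * P = 1\<^sub>m n"
    "A = P * jordan_matrix n_as * Q" "sum_list (map fst n_as) = n"
proof -
  from assms(2) obtain P Q where "similar_mat_wit A (jordan_matrix n_as) P Q"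
    unfolding jordan_nf_def similar_mat_def by auto
  note w = similar_mat_witD2[OF A this]
  have "sum_list (map fst n_as) = n" using w(5) jordan_matrix_dim(1)[of n_as] by auto
  with w show thesis using that by blast
qed

abbreviation nilpotent_jordan :: "nat list \<Rightarrow> 'a::{zero,one} mat" where
  "nilpotent_jordan ps \<equiv> jordan_matrix (map (\<lambda>m. (m, 0)) ps)"

lemma sum_list_map_fst_nilpotent [simp]:
  "sum_list (map fst (map (\<lambda>m. (m, 0)) ps)) = sum_list ps"
  by (induction ps) auto

lemma nilpotent_jordan_carrier: "nilpotent_jordan ps \<in> carrier_mat (sum_list ps) (sum_list ps)"
  using jordan_matrix_carrier[of "map (\<lambda>m. (m, 0)) ps"] unfolding sum_list_map_fst_nilpotent .

lemma nilpotent_jordan_Cons: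
  "nilpotent_jordan (m # ps) = four_block_mat (jordan_block m 0)
     (0\<^sub>m m (sum_list ps)) (0\<^sub>m (sum_list ps) m) (nilpotent_jordan ps)"
  unfolding list.map jordan_matrix_Cons sum_list_map_fst_nilpotent ..

lemma mod_R_jordan_nf:
  fixes X Y :: "'a::{alg_closed_field,field_char_0} mat"
  assumes "(X, Y) \<in> mod_R n"
  obtains ps where "jordan_nf Y (map (\<lambda>m. (m, 0)) ps)" "sum_list ps = n" "0 \<notin> set ps"
proof -
  have X: "X \<in> carrier_mat n n" and Y: "Y \<in> carrier_mat n n" using assms by (auto simp: mod_R_iff)
  obtain n_as where jnf: "jordan_nf Y n_as" using jordan_nf_exists_alg_closed[OF Y] by blast
  obtain P Q where w: "P \<in> carrier_mat n n" "Q \<in> carrier_mat n n" "P * Q = 1\<^sub>m n" "Q * P = 1\<^sub>m n"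
    "Y = P * jordan_matrix n_as * Q" "sum_list (map fst n_as) = n"
    using jordan_nf_obtain[OF Y jnf] by blast
  have J: "jordan_matrix n_as \<in> carrier_mat n n" using jordan_matrix_carrier[of n_as] w(6) by simp
  have "(Q * X * P, Q * Y * P) \<in> mod_R n" by (rule mod_R_conjugate[OF assms w(2,1,3)])
  moreover have "Q * Y * P = jordan_matrix n_as"
    unfolding w(5) by (rule conjugate_inverse[OF w(2,1,4) J])
  ultimately have "Q * X * P \<in> carrier_mat n n"
    "(Q * X * P) * jordan_matrix n_as = jordan_matrix n_as * (Q * X * P) + jordan_matrix n_as * jordan_matrix n_as"
    by (auto simp: mod_R_iff)
  with w(6) have "a = 0" if "(m, a) \<in> set n_as" "m > 0" for m a
    using jordan_commutator_eigenvalues[of "Q * X * P" n_as m a] that by simp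
  moreover have pos: "0 \<notin> fst ` set n_as" using jnf by (simp add: jordan_nf_def)
  ultimately have "snd p = 0" if "p \<in> set n_as" for p
    using that by (metis gr0I image_eqI prod.collapse)
  then have "n_as = map (\<lambda>m. (m, 0)) (map fst n_as)"
    by (simp add: map_idI prod_eq_iff)
  then show thesis using that[of "map fst n_as"] jnf w(6) pos by simp
qed

lemma nilpotent_jordan_pow_eq_0:
  assumes "\<And>m. m \<in> set ps \<Longrightarrow> m \<le> k"
  shows "(nilpotent_jordan ps :: 'a::field mat) ^\<^sub>m k = 0\<^sub>m (sum_list ps) (sum_list ps)"
  using assms
proof (induction ps)
  case Nil
  then show ?case by (intro eq_matI) (auto simp: jordan_matrix_def)
next
  case (Cons m ps)
  have "(jordan_block m 0 :: 'a mat) ^\<^sub>m k = 0\<^sub>m m m"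
    unfolding jordan_block_zero_pow using Cons.prems[of m] by (intro eq_matI) auto
  then show ?case
    unfolding nilpotent_jordan_Cons
      pow_four_block_mat[OF jordan_block_carrier nilpotent_jordan_carrier]
    using Cons.IH Cons.prems by (simp del: list.map)
qed

lemma jordan_nf_nilpotent_pow_eq_0:
  fixes Y :: "'a::field mat"
  assumes Y: "Y \<in> carrier_mat n n" and jnf: "jordan_nf Y (map (\<lambda>m. (m, 0)) ps)"
    and "\<And>m. m \<in> set ps \<Longrightarrow> m \<le> k"
  shows "Y ^\<^sub>m k = 0\<^sub>m n n"
proof -
  obtain P Q where w: "similar_mat_wit Y (nilpotent_jordan ps) P Q"
    using jnf unfolding jordan_nf_def similar_mat_def by auto
  note D = similar_mat_witD2[OF Y w]
  have n: "sum_list ps = n" using D(5) nilpotent_jordan_carrier[of ps] by (metis carrier_matD(1))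
  have "nilpotent_jordan ps ^\<^sub>m k = (0\<^sub>m n n :: 'a mat)"
    using nilpotent_jordan_pow_eq_0[of ps k] assms(3) n by blast
  then show ?thesis unfolding similar_mat_wit_pow_id[OF w] using D(6,7) by simp
qed

lemma mod_R_nilpotent:
  fixes X Y :: "'a::{alg_closed_field,field_char_0} mat"
  assumes "(X, Y) \<in> mod_R n"
  shows "Y ^\<^sub>m n = 0\<^sub>m n n"
proof -
  obtain ps where ps: "jordan_nf Y (map (\<lambda>m. (m, 0)) ps)" "sum_list ps = n"
    using mod_R_jordan_nf[OF assms] by blast
  have "m \<le> n" if "m \<in> set ps" for m using member_le_sum_list[OF that] ps(2) by simp
  then show ?thesis using assms by (intro jordan_nf_nilpotent_pow_eq_0[OF _ ps(1)]) (auto simp: mod_R_iff)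
qed

text \<open>All eigenvalues vanish, and the trace of the Jordan form is the sum of the eigenvalues.\<close>

lemma mat_trace_nilpotent:
  fixes A :: "'a::alg_closed_field mat"
  assumes A: "A \<in> carrier_mat n n" and nil: "A ^\<^sub>m k = 0\<^sub>m n n"
  shows "mat_trace A = 0"
proof -
  obtain n_as where jnf: "jordan_nf A n_as" using jordan_nf_exists_alg_closed[OF A] by blast
  have "a = 0" if mem: "(m, a) \<in> set n_as" for m a
  proof -
    have "m > 0" using jnf mem by (force simp: jordan_nf_def intro: gr0I)
    have "poly (char_poly A) a = prod_list (map (\<lambda>x. poly (case x of (n, a) \<Rightarrow> [:- a, 1:] ^ n) a) n_as)"
      unfolding jordan_nf_char_poly[OF jnf] poly_prod_list by (simp add: o_def)
    also have "\<dots> = 0" using mem \<open>m > 0\<close> by (force simp: prod_list_zero_iff)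
    finally obtain v where v: "eigenvector A v a"
      using eigenvalue_root_char_poly[OF A] by (auto simp: eigenvalue_def)
    then have vc: "v \<in> carrier_vec n" "v \<noteq> 0\<^sub>v n" using A by (auto simp: eigenvector_def)
    have "0\<^sub>m n n *\<^sub>v v = 0\<^sub>v n" using vc by (intro eq_vecI) auto
    then have "a ^ k \<cdot>\<^sub>v v = 0\<^sub>v n" using eigenvector_pow[OF A v, of k] nil by simp
    moreover obtain i where "i < n" "v $ i \<noteq> 0"
      using vc by (metis carrier_vecD eq_vecI index_zero_vec)
    ultimately have "a ^ k * v $ i = 0" using vc by (metis carrier_vecD index_smult_vec(1) index_zero_vec(1))
    with \<open>v $ i \<noteq> 0\<close> show "a = 0" by simp
  qed
  then have "\<forall>p\<in>set n_as. snd p = 0" by auto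
  then have tr: "mat_trace (jordan_matrix n_as) = 0"
    unfolding mat_trace_jordan_matrix by (induction n_as) auto
  obtain P Q where w: "P \<in> carrier_mat n n" "Q \<in> carrier_mat n n" "Q * P = 1\<^sub>m n"
    "A = P * jordan_matrix n_as * Q" "sum_list (map fst n_as) = n"
    using jordan_nf_obtain[OF A jnf] by blast
  have J: "jordan_matrix n_as \<in> carrier_mat n n" using jordan_matrix_carrier[of n_as] w(5) by simp
  have "A = P * (jordan_matrix n_as * Q)" using w J by (simp add: assoc_mult_mat[of _ n n _ n _ n])
  also have "mat_trace \<dots> = mat_trace (jordan_matrix n_as * Q * P)"
    using w J by (intro mat_trace_mult_comm[of _ n n]) auto
  also have "jordan_matrix n_as * Q * P = jordan_matrix n_as * (Q * P)"
    using w(1,2) J by (simp add: assoc_mult_mat[of _ n n _ n _ n])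
  finally show ?thesis using tr right_mult_one_mat[OF J] by (simp add: w(3))
qed

section \<open>Constructing modules\<close>

lemma mod_R_four_block:
  assumes "(X1, Y1) \<in> mod_R n" "(X2, Y2) \<in> mod_R m"
  shows "(four_block_mat X1 (0\<^sub>m n m) (0\<^sub>m m n) X2, four_block_mat Y1 (0\<^sub>m n m) (0\<^sub>m m n) Y2) \<in> mod_R (n + m)"
proof -
  have 1: "X1 \<in> carrier_mat n n" "Y1 \<in> carrier_mat n n" "X1 * Y1 = Y1 * X1 + Y1 * Y1"
    and 2: "X2 \<in> carrier_mat m m" "Y2 \<in> carrier_mat m m" "X2 * Y2 = Y2 * X2 + Y2 * Y2"
    using assms by (auto simp: mod_R_iff)
  note z = zero_carrier_mat
  have mult: "four_block_mat A (0\<^sub>m n m) (0\<^sub>m m n) A' * four_block_mat B (0\<^sub>m n m) (0\<^sub>m m n) B' =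
      four_block_mat (A * B) (0\<^sub>m n m) (0\<^sub>m m n) (A' * B')"
    if "A \<in> carrier_mat n n" "A' \<in> carrier_mat m m" "B \<in> carrier_mat n n" "B' \<in> carrier_mat m m"
    for A A' B B' :: "'a mat"
    using four_block_mult_diag(1)[OF that(1) z z that(2,3,4)] that by simp
  have "four_block_mat (Y1 * X1) (0\<^sub>m n m) (0\<^sub>m m n) (Y2 * X2) + four_block_mat (Y1 * Y1) (0\<^sub>m n m) (0\<^sub>m m n) (Y2 * Y2) =
     four_block_mat (Y1 * X1 + Y1 * Y1) (0\<^sub>m n m) (0\<^sub>m m n) (Y2 * X2 + Y2 * Y2)"
    using 1(1,2) 2(1,2) by (subst add_four_block_mat[of _ n n _ m _ m]) auto
  then show ?thesis unfolding mod_R_iff using 1 2 by (simp add: mult)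
qed

lemma mod_R_add_scalar:
  assumes "(X, Y) \<in> mod_R n"
  shows "(X + c \<cdot>\<^sub>m 1\<^sub>m n, Y) \<in> mod_R n"
proof -
  have X: "X \<in> carrier_mat n n" and Y: "Y \<in> carrier_mat n n" and e: "X * Y = Y * X + Y * Y"
    using assms by (auto simp: mod_R_iff)
  have l: "(X + c \<cdot>\<^sub>m 1\<^sub>m n) * Y = X * Y + c \<cdot>\<^sub>m Y"
    using X Y by (simp add: add_mult_distrib_mat[of _ n n] mult_smult_assoc_mat[of _ n n])
  have r: "Y * (X + c \<cdot>\<^sub>m 1\<^sub>m n) = Y * X + c \<cdot>\<^sub>m Y"
    using X Y by (simp add: mult_add_distrib_mat[of _ n n] mult_smult_distrib[of Y n n "1\<^sub>m n" n])
  have "Y * X \<in> carrier_mat n n" "Y * Y \<in> carrier_mat n n" using X Y by auto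
  then have "X * Y + c \<cdot>\<^sub>m Y = Y * X + c \<cdot>\<^sub>m Y + Y * Y"
    unfolding e using Y by (intro eq_matI) auto
  then show ?thesis unfolding mod_R_iff l r using X Y by simp
qed

lemma jordan_block_0_mult_index:
  fixes M :: "'a::comm_ring_1 mat"
  assumes "M \<in> carrier_mat m m" "i < m" "j < m"
  shows "(jordan_block m 0 * M) $$ (i, j) = (if Suc i < m then M $$ (Suc i, j) else 0)"
    "(M * jordan_block m 0) $$ (i, j) = (if j = 0 then 0 else M $$ (i, j - 1))"
proof -
  have "(jordan_block m 0 * M) $$ (i, j) = (\<Sum>k\<in>{0..<m}. jordan_block m 0 $$ (i, k) * M $$ (k, j))"
    using assms by (simp add: scalar_prod_def)
  also have "\<dots> = (\<Sum>k\<in>{0..<m}. if k = Suc i then M $$ (k, j) else 0)"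
    by (rule sum.cong[OF refl]) (use assms in auto)
  also have "\<dots> = (if Suc i < m then M $$ (Suc i, j) else 0)" by (simp add: sum.delta)
  finally show "(jordan_block m 0 * M) $$ (i, j) = (if Suc i < m then M $$ (Suc i, j) else 0)" .
  have "(M * jordan_block m 0) $$ (i, j) = (\<Sum>k\<in>{0..<m}. M $$ (i, k) * jordan_block m 0 $$ (k, j))"
    using assms by (simp add: scalar_prod_def)
  also have "\<dots> = (\<Sum>k\<in>{0..<m}. if k = j - 1 then (if j = 0 then 0 else M $$ (i, k)) else 0)"
    by (rule sum.cong[OF refl]) (use assms in auto)
  also have "\<dots> = (if j = 0 then 0 else M $$ (i, j - 1))" using assms by (auto simp: sum.delta)
  finally show "(M * jordan_block m 0) $$ (i, j) = (if j = 0 then 0 else M $$ (i, j - 1))" .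
qed

text \<open>On the standard basis the Jordan block lowers the index by one. Here \<open>X\<close> also lowers
the index by one, with weight \<open>-j\<close> on the basis vector \<open>e\<^sub>j\<close>; the weights are chosen so that consecutive
ones differ by \<open>1\<close>, which is exactly the coefficient of \<open>Y\<^sup>2\<close>.\<close>

lemma mod_R_jordan_block:
  "(mat m m (\<lambda>(i, j). if j = Suc i then - of_nat j else 0), jordan_block m 0)
    \<in> (mod_R m :: ('a::field mat \<times> 'a mat) set)"
proof -
  let ?X = "mat m m (\<lambda>(i, j). if j = Suc i then - of_nat j else 0) :: 'a mat"
  let ?J = "jordan_block m 0 :: 'a mat"
  have X: "?X \<in> carrier_mat m m" and J: "?J \<in> carrier_mat m m" by auto
  have "?X * ?J = ?J * ?X + ?J * ?J"
  proof (rule eq_matI)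
    fix i j assume "i < dim_row (?J * ?X + ?J * ?J)" "j < dim_col (?J * ?X + ?J * ?J)"
    then have ij: "i < m" "j < m" by auto
    have "(?J * ?X + ?J * ?J) $$ (i, j) = (?J * ?X) $$ (i, j) + (?J * ?J) $$ (i, j)"
      using ij by simp
    also have "\<dots> = (?X * ?J) $$ (i, j)"
      unfolding jordan_block_0_mult_index(1)[OF X ij] jordan_block_0_mult_index(1)[OF J ij]
        jordan_block_0_mult_index(2)[OF X ij]
      using ij by (cases j) auto
    finally show "(?X * ?J) $$ (i, j) = (?J * ?X + ?J * ?J) $$ (i, j)" ..
  qed auto
  then show ?thesis by (simp add: mod_R_iff)
qed

lemma mod_R_nilpotent_jordan_exists:
  "\<exists>A. (A, nilpotent_jordan ps) \<in> (mod_R (sum_list ps) :: ('a::field mat \<times> 'a mat) set)"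
proof (induction ps)
  case Nil
  have "(0\<^sub>m 0 0, nilpotent_jordan []) \<in> (mod_R 0 :: ('a mat \<times> 'a mat) set)"
    using nilpotent_jordan_carrier[of "[]"] unfolding mod_R_iff by (auto intro!: eq_matI)
  then show ?case by auto
next
  case (Cons m ps)
  then obtain A :: "'a mat" where "(A, nilpotent_jordan ps) \<in> mod_R (sum_list ps)" by blast
  from mod_R_four_block[OF mod_R_jordan_block[of m] this] show ?case
    unfolding nilpotent_jordan_Cons by auto
qed

section \<open>Fitting decomposition of X\<close>

lemma pow_mat_Suc_left:
  fixes A :: "'a::semiring_1 mat"
  assumes "A \<in> carrier_mat n n"
  shows "A ^\<^sub>m Suc k = A * A ^\<^sub>m k"
proof (induction k)
  case (Suc k)
  have "A ^\<^sub>m Suc (Suc k) = A * A ^\<^sub>m k * A" using Suc by simp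
  also have "\<dots> = A * A ^\<^sub>m Suc k" using assms by (simp add: assoc_mult_mat[of _ n n _ n _ n])
  finally show ?case .
qed (use assms in simp)

lemma pow_mat_add:
  fixes A :: "'a::semiring_1 mat"
  assumes "A \<in> carrier_mat n n"
  shows "A ^\<^sub>m (i + j) = A ^\<^sub>m i * A ^\<^sub>m j"
proof (induction j)
  case (Suc j)
  have "A ^\<^sub>m i * A ^\<^sub>m j * A = A ^\<^sub>m i * (A ^\<^sub>m j * A)"
    using assms by (intro assoc_mult_mat[of _ n n _ n _ n]) auto
  then show ?case by (simp add: Suc)
qed (use assms in simp)

lemma mod_R_commute_pow:
  fixes X Y :: "'a::field mat"
  assumes "(X, Y) \<in> mod_R n"
  shows "X * Y ^\<^sub>m k = Y ^\<^sub>m k * X + of_nat k \<cdot>\<^sub>m Y ^\<^sub>m Suc k"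
proof -
  have X: "X \<in> carrier_mat n n" and Y: "Y \<in> carrier_mat n n" and e: "X * Y = Y * X + Y * Y"
    using assms by (auto simp: mod_R_iff)
  have c: "Y ^\<^sub>m k \<in> carrier_mat n n" for k using Y by simp
  note asc = assoc_mult_mat[of _ n n _ n _ n]
  show ?thesis
  proof (induction k)
    case 0
    then show ?case using X Y by (intro eq_matI) auto
  next
    case (Suc k)
    let ?P = "Y ^\<^sub>m k"
    have "X * Y ^\<^sub>m Suc k = (X * ?P) * Y" using asc[OF X c[of k] Y] by simp
    also have "\<dots> = ?P * X * Y + (of_nat k \<cdot>\<^sub>m Y ^\<^sub>m Suc k) * Y"
      unfolding Suc by (rule add_mult_distrib_mat[OF mult_carrier_mat[OF c X] smult_carrier_mat[OF c] Y])
    also have "(of_nat k \<cdot>\<^sub>m Y ^\<^sub>m Suc k) * Y = of_nat k \<cdot>\<^sub>m Y ^\<^sub>m Suc (Suc k)"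
      using mult_smult_assoc_mat[OF c[of "Suc k"] Y] by simp
    also have "?P * X * Y = ?P * (X * Y)" by (rule asc[OF c X Y])
    also have "\<dots> = ?P * (Y * X) + ?P * (Y * Y)"
      unfolding e by (rule mult_add_distrib_mat[OF c mult_carrier_mat[OF Y X] mult_carrier_mat[OF Y Y]])
    also have "?P * (Y * X) = Y ^\<^sub>m Suc k * X" using asc[OF c[of k] Y X] by simp
    also have "?P * (Y * Y) = Y ^\<^sub>m Suc (Suc k)" using asc[OF c[of k] Y Y] by simp
    finally have "X * Y ^\<^sub>m Suc k =
      Y ^\<^sub>m Suc k * X + Y ^\<^sub>m Suc (Suc k) + of_nat k \<cdot>\<^sub>m Y ^\<^sub>m Suc (Suc k)" .
    moreover have "A + B + of_nat k \<cdot>\<^sub>m B = A + of_nat (Suc k) \<cdot>\<^sub>m B"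
      if "A \<in> carrier_mat n n" "B \<in> carrier_mat n n" for A B :: "'a mat"
      using that by (intro eq_matI) (auto simp: algebra_simps)
    moreover have "Y ^\<^sub>m Suc k * X \<in> carrier_mat n n" using c X by (rule mult_carrier_mat)
    ultimately show ?case using c[of "Suc (Suc k)"] by simp
  qed
qed

text \<open>A high power of \<open>X\<close> can be moved past \<open>Y\<^sup>k\<close>: each step past costs a factor \<open>X\<close> or raises the power
of \<open>Y\<close>, and the latter can happen only \<open>N - k\<close> times before \<open>Y\<^sup>N = 0\<close>. With \<open>k = 1\<close> this says that \<open>Y\<close>
preserves the generalised kernel of \<open>X\<close>.\<close>

lemma mod_R_pow_absorb_left:
  fixes X Y :: "'a::field mat"
  assumes XY: "(X, Y) \<in> mod_R n" and nil: "Y ^\<^sub>m N = 0\<^sub>m n n" and "N \<le> k + j"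
  shows "\<exists>Q\<in>carrier_mat n n. X ^\<^sub>m (i + j) * Y ^\<^sub>m k = Q * X ^\<^sub>m i"
proof -
  have X: "X \<in> carrier_mat n n" and Y: "Y \<in> carrier_mat n n" using XY by (auto simp: mod_R_iff)
  have cX: "X ^\<^sub>m k \<in> carrier_mat n n" and cY: "Y ^\<^sub>m k \<in> carrier_mat n n" for k using X Y by simp_all
  note asc = assoc_mult_mat[of _ n n _ n _ n]
  show ?thesis using assms(3)
  proof (induction j arbitrary: i k)
    case 0
    then obtain d where "k = N + d" by (metis add_0_right le_Suc_ex)
    then have "Y ^\<^sub>m k = 0\<^sub>m n n" using pow_mat_add[OF Y, of N d] nil left_mult_zero_mat[OF cY[of d]] by simp
    then show ?case using left_mult_zero_mat[OF cX[of i], of n] right_mult_zero_mat[OF cX[of i], of n]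
      by (intro bexI[of _ "0\<^sub>m n n"]) simp_all
  next
    case (Suc j)
    note IH = Suc.IH
    show ?case using Suc.prems
    proof (induction i)
      case 0
      have z: "X ^\<^sub>m 0 = 1\<^sub>m n" using X by simp
      have c: "X ^\<^sub>m Suc j * Y ^\<^sub>m k \<in> carrier_mat n n" by (rule mult_carrier_mat[OF cX cY])
      have "X ^\<^sub>m (0 + Suc j) * Y ^\<^sub>m k = X ^\<^sub>m Suc j * Y ^\<^sub>m k * X ^\<^sub>m 0"
        unfolding z right_mult_one_mat[OF c] add_0_left ..
      then show ?case by (rule bexI[OF _ c])
    next
      case (Suc i)
      have le: "N \<le> Suc k + j" using Suc.prems by simp
      obtain Q1 where Q1: "Q1 \<in> carrier_mat n n" "X ^\<^sub>m (i + Suc j) * Y ^\<^sub>m k = Q1 * X ^\<^sub>m i"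
        using Suc.IH[OF Suc.prems] by (elim bexE) (rule that)
      obtain Q2 where Q2: "Q2 \<in> carrier_mat n n" "X ^\<^sub>m (Suc i + j) * Y ^\<^sub>m Suc k = Q2 * X ^\<^sub>m Suc i"
        using IH[OF le, of "Suc i"] by (elim bexE) (rule that)
      let ?m = "i + Suc j"
      have "X ^\<^sub>m (Suc i + Suc j) * Y ^\<^sub>m k = X ^\<^sub>m ?m * (X * Y ^\<^sub>m k)"
        using asc[OF cX[of ?m] X cY[of k]] by simp
      also have "\<dots> = X ^\<^sub>m ?m * (Y ^\<^sub>m k * X) + X ^\<^sub>m ?m * (of_nat k \<cdot>\<^sub>m Y ^\<^sub>m Suc k)"
        unfolding mod_R_commute_pow[OF XY]
        by (rule mult_add_distrib_mat[OF cX mult_carrier_mat[OF cY X] smult_carrier_mat[OF cY]])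
      also have "X ^\<^sub>m ?m * (Y ^\<^sub>m k * X) = (X ^\<^sub>m ?m * Y ^\<^sub>m k) * X"
        by (rule asc[symmetric, OF cX cY X])
      also have "\<dots> = Q1 * X ^\<^sub>m Suc i" unfolding Q1(2) using asc[OF Q1(1) cX X] by simp
      also have "X ^\<^sub>m ?m * (of_nat k \<cdot>\<^sub>m Y ^\<^sub>m Suc k) = of_nat k \<cdot>\<^sub>m (X ^\<^sub>m (Suc i + j) * Y ^\<^sub>m Suc k)"
        using mult_smult_distrib[OF cX[of ?m] cY[of "Suc k"], of "of_nat k"] by simp
      also have "\<dots> = (of_nat k \<cdot>\<^sub>m Q2) * X ^\<^sub>m Suc i"
        unfolding Q2(2) by (rule mult_smult_assoc_mat[symmetric, OF Q2(1) cX])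
      also have "Q1 * X ^\<^sub>m Suc i + (of_nat k \<cdot>\<^sub>m Q2) * X ^\<^sub>m Suc i = (Q1 + of_nat k \<cdot>\<^sub>m Q2) * X ^\<^sub>m Suc i"
        by (rule add_mult_distrib_mat[symmetric, OF Q1(1) smult_carrier_mat[OF Q2(1)] cX])
      finally have eq: "X ^\<^sub>m (Suc i + Suc j) * Y ^\<^sub>m k = (Q1 + of_nat k \<cdot>\<^sub>m Q2) * X ^\<^sub>m Suc i" .
      have c: "Q1 + of_nat k \<cdot>\<^sub>m Q2 \<in> carrier_mat n n"
        by (rule add_carrier_mat[OF smult_carrier_mat[OF Q2(1)]])
      from eq show ?case by (rule bexI[OF _ c])
    qed
  qed
qed

text \<open>The mirror image; with \<open>k = 1\<close> it says that \<open>Y\<close> preserves the stable image of \<open>X\<close>.\<close>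

lemma mod_R_pow_absorb_right:
  fixes X Y :: "'a::field mat"
  assumes XY: "(X, Y) \<in> mod_R n" and nil: "Y ^\<^sub>m N = 0\<^sub>m n n" and "N \<le> k + j"
  shows "\<exists>Q\<in>carrier_mat n n. Y ^\<^sub>m k * X ^\<^sub>m (i + j) = X ^\<^sub>m i * Q"
proof -
  have X: "X \<in> carrier_mat n n" and Y: "Y \<in> carrier_mat n n" using XY by (auto simp: mod_R_iff)
  have cX: "X ^\<^sub>m k \<in> carrier_mat n n" and cY: "Y ^\<^sub>m k \<in> carrier_mat n n" for k using X Y by simp_all
  note asc = assoc_mult_mat[of _ n n _ n _ n]
  have comm: "Y ^\<^sub>m k * X = X * Y ^\<^sub>m k + (- of_nat k) \<cdot>\<^sub>m Y ^\<^sub>m Suc k" for k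
  proof -
    have "A = A + B + (- of_nat k) \<cdot>\<^sub>m C" if "A \<in> carrier_mat n n" "C \<in> carrier_mat n n" "B = of_nat k \<cdot>\<^sub>m C"
      for A B C :: "'a mat" using that by (intro eq_matI) auto
    from this[OF mult_carrier_mat[OF cY X] cY refl] show ?thesis unfolding mod_R_commute_pow[OF XY] .
  qed
  show ?thesis using assms(3)
  proof (induction j arbitrary: i k)
    case 0
    then obtain d where "k = N + d" by (metis add_0_right le_Suc_ex)
    then have "Y ^\<^sub>m k = 0\<^sub>m n n" using pow_mat_add[OF Y, of N d] nil left_mult_zero_mat[OF cY[of d]] by simp
    then show ?case using left_mult_zero_mat[OF cX[of i], of n] right_mult_zero_mat[OF cX[of i], of n]
      by (intro bexI[of _ "0\<^sub>m n n"]) simp_all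
  next
    case (Suc j)
    note IH = Suc.IH
    show ?case using Suc.prems
    proof (induction i)
      case 0
      have z: "X ^\<^sub>m 0 = 1\<^sub>m n" using X by simp
      have c: "Y ^\<^sub>m k * X ^\<^sub>m Suc j \<in> carrier_mat n n" by (rule mult_carrier_mat[OF cY cX])
      have "Y ^\<^sub>m k * X ^\<^sub>m (0 + Suc j) = X ^\<^sub>m 0 * (Y ^\<^sub>m k * X ^\<^sub>m Suc j)"
        unfolding z left_mult_one_mat[OF c] add_0_left ..
      then show ?case by (rule bexI[OF _ c])
    next
      case (Suc i)
      have le: "N \<le> Suc k + j" using Suc.prems by simp
      obtain Q1 where Q1: "Q1 \<in> carrier_mat n n" "Y ^\<^sub>m k * X ^\<^sub>m (i + Suc j) = X ^\<^sub>m i * Q1"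
        using Suc.IH[OF Suc.prems] by (elim bexE) (rule that)
      obtain Q2 where Q2: "Q2 \<in> carrier_mat n n" "Y ^\<^sub>m Suc k * X ^\<^sub>m (Suc i + j) = X ^\<^sub>m Suc i * Q2"
        using IH[OF le, of "Suc i"] by (elim bexE) (rule that)
      let ?m = "i + Suc j" and ?c = "- of_nat k :: 'a"
      have "X ^\<^sub>m (Suc i + Suc j) = X * X ^\<^sub>m ?m" using pow_mat_Suc_left[OF X, of ?m] by simp
      then have "Y ^\<^sub>m k * X ^\<^sub>m (Suc i + Suc j) = Y ^\<^sub>m k * X * X ^\<^sub>m ?m"
        using asc[OF cY X cX, of k ?m] by simp
      also have "\<dots> = X * Y ^\<^sub>m k * X ^\<^sub>m ?m + (?c \<cdot>\<^sub>m Y ^\<^sub>m Suc k) * X ^\<^sub>m ?m"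
        unfolding comm
        by (rule add_mult_distrib_mat[OF mult_carrier_mat[OF X cY] smult_carrier_mat[OF cY] cX])
      also have "X * Y ^\<^sub>m k * X ^\<^sub>m ?m = X * (X ^\<^sub>m i * Q1)"
        unfolding Q1(2)[symmetric] by (rule asc[OF X cY cX])
      also have "\<dots> = X ^\<^sub>m Suc i * Q1"
        unfolding pow_mat_Suc_left[OF X] by (rule asc[symmetric, OF X cX Q1(1)])
      also have "(?c \<cdot>\<^sub>m Y ^\<^sub>m Suc k) * X ^\<^sub>m ?m = ?c \<cdot>\<^sub>m (Y ^\<^sub>m Suc k * X ^\<^sub>m (Suc i + j))"
        using mult_smult_assoc_mat[OF cY[of "Suc k"] cX[of ?m], of ?c] by simp
      also have "\<dots> = X ^\<^sub>m Suc i * (?c \<cdot>\<^sub>m Q2)"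
        unfolding Q2(2) by (rule mult_smult_distrib[symmetric, OF cX Q2(1)])
      also have "X ^\<^sub>m Suc i * Q1 + X ^\<^sub>m Suc i * (?c \<cdot>\<^sub>m Q2) = X ^\<^sub>m Suc i * (Q1 + ?c \<cdot>\<^sub>m Q2)"
        by (rule mult_add_distrib_mat[symmetric, OF cX Q1(1) smult_carrier_mat[OF Q2(1)]])
      finally have eq: "Y ^\<^sub>m k * X ^\<^sub>m (Suc i + Suc j) = X ^\<^sub>m Suc i * (Q1 + ?c \<cdot>\<^sub>m Q2)" .
      have c: "Q1 + ?c \<cdot>\<^sub>m Q2 \<in> carrier_mat n n"
        by (rule add_carrier_mat[OF smult_carrier_mat[OF Q2(1)]])
      from eq show ?case by (rule bexI[OF _ c])
    qed
  qed
qed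

text \<open>\<open>E\<close> is the projection onto the stable image along the generalised kernel. On a Jordan block with
eigenvalue \<open>0\<close> the projection is \<open>0\<close>; on any other block it is \<open>1\<close> and \<open>F\<close> inverts the power. The two
factorisations of \<open>E\<close> through the power \<open>2 N\<close> are what the absorption lemmas above can be applied to.\<close>

lemma fitting_jordan_matrix:
  fixes n_as :: "(nat \<times> 'a::field) list"
  defines "d \<equiv> sum_list (map fst n_as)" and "J \<equiv> jordan_matrix n_as"
  assumes "\<forall>p\<in>set n_as. fst p \<le> N"
  shows "\<exists>E\<in>carrier_mat d d. \<exists>F\<in>carrier_mat d d.
    J * E = E * J \<and> J ^\<^sub>m N * E = J ^\<^sub>m N \<and> E * J ^\<^sub>m N = J ^\<^sub>m N \<and>
    E = F * J ^\<^sub>m (2 * N) \<and> E = J ^\<^sub>m (2 * N) * F"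
  using assms(3) unfolding d_def J_def
proof (induction n_as)
  case Nil
  have J: "jordan_matrix [] \<in> carrier_mat 0 (0::nat)" using jordan_matrix_carrier[of "[]"] by simp
  have eq: "A = B" if "A \<in> carrier_mat 0 0" "B \<in> carrier_mat 0 0" for A B :: "'a mat"
    using that by (intro eq_matI) auto
  show ?case using J
    by (intro bexI[of _ "0\<^sub>m 0 0"] conjI; (rule eq)?) auto
next
  case (Cons p n_as)
  obtain m a where p: "p = (m, a)" by force
  let ?d = "sum_list (map fst n_as)" and ?J = "jordan_matrix n_as"
  let ?B = "jordan_block m a"
  have B: "?B \<in> carrier_mat m m" and J: "?J \<in> carrier_mat ?d ?d" by auto
  obtain E F where EF: "E \<in> carrier_mat ?d ?d" "F \<in> carrier_mat ?d ?d" "?J * E = E * ?J"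
    "?J ^\<^sub>m N * E = ?J ^\<^sub>m N" "E * ?J ^\<^sub>m N = ?J ^\<^sub>m N"
    "E = F * ?J ^\<^sub>m (2 * N)" "E = ?J ^\<^sub>m (2 * N) * F"
  proof -
    have "\<forall>p\<in>set n_as. fst p \<le> N" using Cons.prems by simp
    from Cons.IH[OF this] show thesis by (elim bexE conjE) (rule that)
  qed
  obtain E1 F1 where EF1: "E1 \<in> carrier_mat m m" "F1 \<in> carrier_mat m m" "?B * E1 = E1 * ?B"
    "?B ^\<^sub>m N * E1 = ?B ^\<^sub>m N" "E1 * ?B ^\<^sub>m N = ?B ^\<^sub>m N"
    "E1 = F1 * ?B ^\<^sub>m (2 * N)" "E1 = ?B ^\<^sub>m (2 * N) * F1"
  proof (cases "a = 0")
    case True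
    have "m \<le> N" using Cons.prems by (simp add: p)
    then have "?B ^\<^sub>m N = 0\<^sub>m m m" unfolding True jordan_block_zero_pow by (intro eq_matI) auto
    moreover have "?B ^\<^sub>m (2 * N) \<in> carrier_mat m m" by simp
    ultimately show thesis using B by (intro that[of "0\<^sub>m m m" "0\<^sub>m m m"]) simp_all
  next
    case False
    let ?C = "?B ^\<^sub>m (2 * N)"
    have C: "?C \<in> carrier_mat m m" by simp
    have "det ?C = prod_list (diag_mat ?C)"
      by (rule det_upper_triangular[OF _ C]) (auto simp: jordan_block_pow)
    then have "det ?C \<noteq> 0" using False by (simp add: diag_jordan_block_pow prod_list_replicate)
    note inv = inverse_via_adjugate[OF C this]
    show thesis
      by (rule that[OF one_carrier_mat inv(1)]) (use inv(2,3) B in simp_all)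
  qed
  let ?dg = "\<lambda>A D. four_block_mat A (0\<^sub>m m ?d) (0\<^sub>m ?d m) D"
  have mult: "?dg A D * ?dg A' D' = ?dg (A * A') (D * D')"
    if "A \<in> carrier_mat m m" "D \<in> carrier_mat ?d ?d" "A' \<in> carrier_mat m m" "D' \<in> carrier_mat ?d ?d"
    for A A' D D' :: "'a mat"
    using four_block_mult_diag(1)[OF that(1) zero_carrier_mat zero_carrier_mat that(2,3,4)] that by simp
  have pow: "?dg ?B ?J ^\<^sub>m k = ?dg (?B ^\<^sub>m k) (?J ^\<^sub>m k)" for k by (rule pow_four_block_mat[OF B J])
  have cB: "?B ^\<^sub>m k \<in> carrier_mat m m" and cJ: "?J ^\<^sub>m k \<in> carrier_mat ?d ?d" for k
    by simp_all
  have "?dg ?B ?J * ?dg E1 E = ?dg E1 E * ?dg ?B ?J"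
    unfolding mult[OF B J EF1(1) EF(1)] mult[OF EF1(1) EF(1) B J] EF1(3) EF(3) ..
  moreover have "?dg ?B ?J ^\<^sub>m N * ?dg E1 E = ?dg ?B ?J ^\<^sub>m N"
    unfolding pow mult[OF cB cJ EF1(1) EF(1)] EF1(4) EF(4) ..
  moreover have "?dg E1 E * ?dg ?B ?J ^\<^sub>m N = ?dg ?B ?J ^\<^sub>m N"
    unfolding pow mult[OF EF1(1) EF(1) cB cJ] EF1(5) EF(5) ..
  moreover have "?dg E1 E = ?dg F1 F * ?dg ?B ?J ^\<^sub>m (2 * N)"
    unfolding pow mult[OF EF1(2) EF(2) cB cJ] EF1(6)[symmetric] EF(6)[symmetric] ..
  moreover have "?dg E1 E = ?dg ?B ?J ^\<^sub>m (2 * N) * ?dg F1 F"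
    unfolding pow mult[OF cB cJ EF1(2) EF(2)] EF1(7)[symmetric] EF(7)[symmetric] ..
  moreover have "?dg E1 E \<in> carrier_mat (m + ?d) (m + ?d)" "?dg F1 F \<in> carrier_mat (m + ?d) (m + ?d)"
    using four_block_carrier_mat[OF EF1(1) EF(1)] four_block_carrier_mat[OF EF1(2) EF(2)] by auto
  ultimately show ?case
    unfolding p jordan_matrix_Cons list.map sum_list.Cons fst_conv
    by (intro bexI[of _ "?dg E1 E"] bexI[of _ "?dg F1 F"] conjI)
qed

lemma fitting_decomposition:
  fixes A :: "'a::alg_closed_field mat"
  assumes A: "A \<in> carrier_mat n n"
  obtains E F where "E \<in> carrier_mat n n" "F \<in> carrier_mat n n" "A * E = E * A"
    "A ^\<^sub>m n * E = A ^\<^sub>m n" "E * A ^\<^sub>m n = A ^\<^sub>m n" "E = F * A ^\<^sub>m (2 * n)" "E = A ^\<^sub>m (2 * n) * F"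
proof -
  obtain n_as where jnf: "jordan_nf A n_as" using jordan_nf_exists_alg_closed[OF A] by blast
  let ?J = "jordan_matrix n_as"
  from jnf obtain P Q where w: "similar_mat_wit A ?J P Q"
    unfolding jordan_nf_def similar_mat_def by auto
  note D = similar_mat_witD2[OF A w]
  note P = D(6) and Q = D(7)
  have n: "sum_list (map fst n_as) = n"
    using D(5) jordan_matrix_carrier[of n_as] by (metis carrier_matD(1))
  have le: "\<forall>p\<in>set n_as. fst p \<le> n"
    using member_le_sum_list[of _ "map fst n_as"] n by force
  obtain E F where EF: "E \<in> carrier_mat n n" "F \<in> carrier_mat n n" "?J * E = E * ?J"
    "?J ^\<^sub>m n * E = ?J ^\<^sub>m n" "E * ?J ^\<^sub>m n = ?J ^\<^sub>m n"
    "E = F * ?J ^\<^sub>m (2 * n)" "E = ?J ^\<^sub>m (2 * n) * F"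
    using fitting_jordan_matrix[of n_as n, OF le] unfolding n by (elim bexE conjE) (rule that)
  note pow = similar_mat_wit_pow_id[OF w]
  note conj = conjugate_mult[OF P Q D(2)]
  have cJ: "?J ^\<^sub>m k \<in> carrier_mat n n" for k using D(5) by simp
  show thesis
  proof (rule that[of "P * E * Q" "P * F * Q"])
    show "A * (P * E * Q) = P * E * Q * A"
      unfolding D(3) conj[OF D(5) EF(1)] conj[OF EF(1) D(5)] EF(3) ..
    show "A ^\<^sub>m n * (P * E * Q) = A ^\<^sub>m n" unfolding pow conj[OF cJ EF(1)] EF(4) ..
    show "P * E * Q * A ^\<^sub>m n = A ^\<^sub>m n" unfolding pow conj[OF EF(1) cJ] EF(5) ..
    show "P * E * Q = P * F * Q * A ^\<^sub>m (2 * n)" unfolding pow conj[OF EF(2) cJ] EF(6)[symmetric] ..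
    show "P * E * Q = A ^\<^sub>m (2 * n) * (P * F * Q)" unfolding pow conj[OF cJ EF(2)] EF(7)[symmetric] ..
  qed (use P Q EF in auto)
qed

section \<open>Indecomposable modules\<close>

lemma R_submodule_iff:
  "R_submodule n M W \<longleftrightarrow> W \<subseteq> carrier_vec n \<and> 0\<^sub>v n \<in> W \<and>
     (\<forall>v\<in>W. \<forall>w\<in>W. v + w \<in> W) \<and> (\<forall>c. \<forall>v\<in>W. c \<cdot>\<^sub>v v \<in> W) \<and>
     (\<forall>w\<in>W. fst M *\<^sub>v w \<in> W \<and> snd M *\<^sub>v w \<in> W)"
  for M :: "'k::field mat \<times> 'k mat"
proof -
  have "VectorSpace.subspace class_ring W (module_vec TYPE('k) n) \<longleftrightarrow>
    W \<subseteq> carrier_vec n \<and> (\<forall>v\<in>W. \<forall>w\<in>W. v + w \<in> W) \<and> 0\<^sub>v n \<in> W \<and> (\<forall>c. \<forall>v\<in>W. c \<cdot>\<^sub>v v \<in> W)"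
    unfolding VectorSpace.subspace_def submodule_def
    using vec_vs[of n, where ?'a = 'k] vec_module[of n, where ?'a = 'k]
    by (auto simp: module_vec_def)
  then show ?thesis unfolding R_submodule_def by blast
qed

lemma mat_eq_via_mult_vec:
  fixes A :: "'a::comm_ring_1 mat"
  assumes A: "A \<in> carrier_mat n n" and B: "B \<in> carrier_mat n n"
    and eq: "\<And>v. v \<in> carrier_vec n \<Longrightarrow> A *\<^sub>v v = B *\<^sub>v v"
  shows "A = B"
proof (rule mat_col_eqI)
  fix j assume "j < dim_col B"
  then have j: "j < n" using B by simp
  have "col A j = A *\<^sub>v unit_vec n j" using A j by (intro eq_vecI) auto
  also have "\<dots> = B *\<^sub>v unit_vec n j" using j by (intro eq) simp
  also have "\<dots> = col B j" using B j by (intro eq_vecI) auto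
  finally show "col A j = col B j" .
qed (use A B in auto)

text \<open>Such an \<open>E\<close> is an idempotent endomorphism of the module, which splits it into image and kernel.\<close>

lemma R_indecomposable_idempotent:
  fixes X Y :: "'k::field mat"
  assumes X: "X \<in> carrier_mat n n" and Y: "Y \<in> carrier_mat n n" and E: "E \<in> carrier_mat n n"
    and EE: "E * E = E" and XE: "X * E = E * X" and YE: "Y * E = E * Y"
    and ind: "R_indecomposable n (X, Y)"
  shows "E = 0\<^sub>m n n \<or> E = 1\<^sub>m n"
proof -
  define W1 where "W1 = {v \<in> carrier_vec n. E *\<^sub>v v = v}"
  define W2 where "W2 = {v \<in> carrier_vec n. E *\<^sub>v v = 0\<^sub>v n}"
  have zero: "A *\<^sub>v 0\<^sub>v n = 0\<^sub>v n" if "A \<in> carrier_mat n n" for A :: "'k mat"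
    using that by (intro eq_vecI) auto
  have comm: "E *\<^sub>v (Z *\<^sub>v v) = Z *\<^sub>v (E *\<^sub>v v)"
    if "Z \<in> carrier_mat n n" "Z * E = E * Z" "v \<in> carrier_vec n" for Z v
    using that E assoc_mult_mat_vec[of E n n Z n v] assoc_mult_mat_vec[of Z n n E n v] by simp
  have add: "E *\<^sub>v (v + w) = E *\<^sub>v v + E *\<^sub>v w" if "v \<in> carrier_vec n" "w \<in> carrier_vec n" for v w
    using that E by (intro mult_add_distrib_mat_vec) auto
  have smult: "E *\<^sub>v (c \<cdot>\<^sub>v v) = c \<cdot>\<^sub>v (E *\<^sub>v v)" if "v \<in> carrier_vec n" for c v
    using that E by (intro mult_mat_vec) auto
  have s1: "R_submodule n (X, Y) W1"
    unfolding R_submodule_iff W1_def using X Y XE YE by (auto simp: zero[OF E] add smult comm)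
  have c0: "c \<cdot>\<^sub>v 0\<^sub>v n = (0\<^sub>v n :: 'k vec)" for c by (intro eq_vecI) auto
  have s2: "R_submodule n (X, Y) W2"
    unfolding R_submodule_iff W2_def using X Y XE YE
    by (auto simp: zero[OF E] zero[OF X] zero[OF Y] add smult comm c0)
  have E1: "E *\<^sub>v v \<in> W1" if "v \<in> carrier_vec n" for v
  proof -
    have "E *\<^sub>v (E *\<^sub>v v) = (E * E) *\<^sub>v v" using that E by (intro assoc_mult_mat_vec[symmetric]) auto
    then show ?thesis using that E by (simp add: W1_def EE)
  qed
  have E2: "v - E *\<^sub>v v \<in> W2" if v: "v \<in> carrier_vec n" for v
  proof -
    have c: "E *\<^sub>v v \<in> carrier_vec n" using E v by simp
    have "E *\<^sub>v (v - E *\<^sub>v v) = E *\<^sub>v v - E *\<^sub>v (E *\<^sub>v v)"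
      by (rule mult_minus_distrib_mat_vec[OF E v c])
    also have "E *\<^sub>v (E *\<^sub>v v) = E *\<^sub>v v" using E1[OF v] by (simp add: W1_def)
    finally show ?thesis using v c by (simp add: W2_def)
  qed
  have "W1 \<inter> W2 = {0\<^sub>v n}" using zero[OF E] by (auto simp: W1_def W2_def)
  moreover have "{w1 + w2 | w1 w2. w1 \<in> W1 \<and> w2 \<in> W2} = carrier_vec n"
  proof (intro equalityI subsetI)
    fix v :: "'k vec" assume v: "v \<in> carrier_vec n"
    have "E *\<^sub>v v + (v - E *\<^sub>v v) = v" using v E by (intro eq_vecI) auto
    then show "v \<in> {w1 + w2 | w1 w2. w1 \<in> W1 \<and> w2 \<in> W2}"
      using E1[OF v] E2[OF v] by (metis (mono_tags, lifting) mem_Collect_eq)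
  qed (auto simp: W1_def W2_def)
  ultimately have "W1 = {0\<^sub>v n} \<or> W2 = {0\<^sub>v n}"
    using ind s1 s2 unfolding R_indecomposable_def by blast
  then show ?thesis
  proof
    assume "W1 = {0\<^sub>v n}"
    then have "E *\<^sub>v v = 0\<^sub>m n n *\<^sub>v v" if "v \<in> carrier_vec n" for v
      using E1[OF that] that by auto
    then have "E = 0\<^sub>m n n" by (intro mat_eq_via_mult_vec[OF E]) auto
    then show ?thesis ..
  next
    assume W2: "W2 = {0\<^sub>v n}"
    have "E *\<^sub>v v = 1\<^sub>m n *\<^sub>v v" if v: "v \<in> carrier_vec n" for v
    proof -
      have z: "v - E *\<^sub>v v = 0\<^sub>v n" using E2[OF v] W2 by simp
      have "E *\<^sub>v v = v"
      proof (rule eq_vecI)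
        fix i assume "i < dim_vec v"
        moreover have "(v - E *\<^sub>v v) $ i = 0\<^sub>v n $ i" by (simp add: z)
        ultimately show "(E *\<^sub>v v) $ i = v $ i" using v E by simp
      qed (use v E in simp)
      then show ?thesis using v by simp
    qed
    then have "E = 1\<^sub>m n" by (intro mat_eq_via_mult_vec[OF E]) auto
    then show ?thesis ..
  qed
qed

text \<open>Let \<open>A = X - a\<close> for an eigenvalue \<open>a\<close>. The Fitting projection \<open>E\<close> of \<open>A\<close> commutes with \<open>X\<close>, and by the two
absorption lemmas also with \<open>Y\<close>, so it is \<open>0\<close> or \<open>1\<close>. It kills the eigenvector, so it is \<open>0\<close>, which
means that \<open>A\<close> is nilpotent.\<close>

lemma R_indecomposable_single_eigenvalue:
  fixes X Y :: "'k::{alg_closed_field,field_char_0} mat"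
  assumes XY: "(X, Y) \<in> mod_R n" and "n \<ge> 1" and ind: "R_indecomposable n (X, Y)"
  shows "\<exists>a. (X - a \<cdot>\<^sub>m 1\<^sub>m n) ^\<^sub>m n = 0\<^sub>m n n"
proof -
  have X: "X \<in> carrier_mat n n" and Y: "Y \<in> carrier_mat n n" using XY by (auto simp: mod_R_iff)
  obtain a where "eigenvalue X a" using eigenvalue_exists[OF X] assms(2) by auto
  then obtain v where v: "eigenvector X v a" by (auto simp: eigenvalue_def)
  then have vc: "v \<in> carrier_vec n" "v \<noteq> 0\<^sub>v n" "X *\<^sub>v v = a \<cdot>\<^sub>v v" using X by (auto simp: eigenvector_def)
  define A where "A = X - a \<cdot>\<^sub>m 1\<^sub>m n"
  have A: "A \<in> carrier_mat n n" using X by (simp add: A_def minus_carrier_mat)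
  have X_eq: "X = A + a \<cdot>\<^sub>m 1\<^sub>m n" unfolding A_def using X by (intro eq_matI) auto
  have A_eq: "A = X + (- a) \<cdot>\<^sub>m 1\<^sub>m n" unfolding A_def using X by (intro eq_matI) auto
  have AY: "(A, Y) \<in> mod_R n" unfolding A_eq by (rule mod_R_add_scalar[OF XY])
  note nil = mod_R_nilpotent[OF XY]
  have cA: "A ^\<^sub>m k \<in> carrier_mat n n" for k using A by simp
  note asc = assoc_mult_mat[of _ n n _ n _ n]
  obtain E F where E: "E \<in> carrier_mat n n" and F: "F \<in> carrier_mat n n" and AE: "A * E = E * A"
    and AnE: "A ^\<^sub>m n * E = A ^\<^sub>m n" "E * A ^\<^sub>m n = A ^\<^sub>m n"
    and EF: "E = F * A ^\<^sub>m (2 * n)" "E = A ^\<^sub>m (2 * n) * F"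
    by (rule fitting_decomposition[OF A])
  have A2: "A ^\<^sub>m (2 * n) = A ^\<^sub>m n * A ^\<^sub>m n" using pow_mat_add[OF A, of n n] by (simp add: mult_2)
  have "E * E = F * (A ^\<^sub>m n * (A ^\<^sub>m n * E))"
  proof -
    have "E * E = F * A ^\<^sub>m (2 * n) * E" by (subst (1) EF(1)) (rule refl)
    also have "\<dots> = F * (A ^\<^sub>m n * A ^\<^sub>m n * E)" unfolding A2 by (rule asc[OF F mult_carrier_mat[OF cA cA] E])
    also have "A ^\<^sub>m n * A ^\<^sub>m n * E = A ^\<^sub>m n * (A ^\<^sub>m n * E)" by (rule asc[OF cA cA E])
    finally show ?thesis .
  qed
  then have EE: "E * E = E" unfolding AnE(1) A2[symmetric] EF(1)[symmetric] .
  obtain Q1 where Q1: "Q1 \<in> carrier_mat n n" "A ^\<^sub>m (n + n) * Y ^\<^sub>m 1 = Q1 * A ^\<^sub>m n"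
    using mod_R_pow_absorb_left[OF AY nil, of 1 n n] by auto
  obtain Q2 where Q2: "Q2 \<in> carrier_mat n n" "Y ^\<^sub>m 1 * A ^\<^sub>m (n + n) = A ^\<^sub>m n * Q2"
    using mod_R_pow_absorb_right[OF AY nil, of 1 n n] by auto
  have Y1: "Y ^\<^sub>m 1 = Y" using Y by simp
  have "E * Y = F * (A ^\<^sub>m (2 * n) * Y)"
    unfolding asc[OF F cA Y, symmetric] EF(1)[symmetric] ..
  also have "\<dots> = F * (Q1 * A ^\<^sub>m n)" using Q1(2) by (simp only: Y1 mult_2)
  finally have EY: "E * Y = F * (Q1 * A ^\<^sub>m n)" .
  have "F * (Q1 * A ^\<^sub>m n) * E = F * (Q1 * A ^\<^sub>m n * E)"
    by (rule asc[OF F mult_carrier_mat[OF Q1(1) cA] E])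
  also have "Q1 * A ^\<^sub>m n * E = Q1 * (A ^\<^sub>m n * E)" by (rule asc[OF Q1(1) cA E])
  finally have EYE1: "E * Y * E = E * Y" unfolding EY AnE(1) .
  have "Y * E = Y * A ^\<^sub>m (2 * n) * F"
    unfolding asc[OF Y cA F] EF(2)[symmetric] ..
  also have "\<dots> = A ^\<^sub>m n * Q2 * F" using Q2(2) by (simp only: Y1 mult_2)
  finally have YE: "Y * E = A ^\<^sub>m n * Q2 * F" .
  have "E * (A ^\<^sub>m n * Q2 * F) = E * (A ^\<^sub>m n * Q2) * F"
    by (rule asc[symmetric, OF E mult_carrier_mat[OF cA Q2(1)] F])
  also have "E * (A ^\<^sub>m n * Q2) = E * A ^\<^sub>m n * Q2" by (rule asc[symmetric, OF E cA Q2(1)])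
  finally have EYE2: "E * (Y * E) = Y * E" unfolding YE AnE(2) .
  have YE': "Y * E = E * Y" using EYE1 EYE2 asc[OF E Y E] by simp
  have XE: "X * E = E * X"
  proof -
    have "X * E = A * E + a \<cdot>\<^sub>m E"
      unfolding X_eq using A E by (simp add: add_mult_distrib_mat[of _ n n] mult_smult_assoc_mat[of _ n n])
    moreover have "E * X = E * A + a \<cdot>\<^sub>m E"
      unfolding X_eq using A E by (simp add: mult_add_distrib_mat[of _ n n] mult_smult_distrib[of E n n "1\<^sub>m n" n])
    ultimately show ?thesis by (simp add: AE)
  qed
  have "E \<noteq> 1\<^sub>m n"
  proof
    assume "E = 1\<^sub>m n"
    have "A *\<^sub>v v = X *\<^sub>v v - a \<cdot>\<^sub>v v"
    proof -
      have "(a \<cdot>\<^sub>m 1\<^sub>m n) *\<^sub>v v = a \<cdot>\<^sub>v v" using vc(1) by (intro eq_vecI) auto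
      then show ?thesis unfolding A_def using minus_mult_distrib_mat_vec[of X n n "a \<cdot>\<^sub>m 1\<^sub>m n" v] X vc(1) by simp
    qed
    then have Av: "A *\<^sub>v v = 0\<^sub>v n" using vc by simp
    then have ev: "eigenvector A v 0" using A vc by (auto simp: eigenvector_def intro: eq_vecI)
    have "A ^\<^sub>m (2 * n) *\<^sub>v v = 0\<^sub>v n"
      using eigenvector_pow[OF A ev, of "2 * n"] assms(2) vc(1) by (auto simp: power_0_left)
    then have "E *\<^sub>v v = F *\<^sub>v 0\<^sub>v n" using EF(1) assoc_mult_mat_vec[OF F cA vc(1)] by metis
    also have "\<dots> = 0\<^sub>v n" using F by (intro eq_vecI) auto
    finally show False using \<open>E = 1\<^sub>m n\<close> vc by simp
  qed
  then have "E = 0\<^sub>m n n" using R_indecomposable_idempotent[OF X Y E EE XE YE' ind] by blast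
  then have "A ^\<^sub>m n = 0\<^sub>m n n" using AnE(1) right_mult_zero_mat[OF cA, of n n] by simp
  then show ?thesis unfolding A_def by blast
qed

text \<open>Naming the eigenvalue as \<open>tr X / n\<close> turns the existential statement into a polynomial
condition on \<open>X\<close>.\<close>

lemma R_indecomposable_centred_nilpotent:
  fixes X Y :: "'k::{alg_closed_field,field_char_0} mat"
  assumes XY: "(X, Y) \<in> mod_R n" and "n \<ge> 1" and ind: "R_indecomposable n (X, Y)"
  shows "(X - (mat_trace X / of_nat n) \<cdot>\<^sub>m 1\<^sub>m n) ^\<^sub>m n = 0\<^sub>m n n"
proof -
  have X: "X \<in> carrier_mat n n" using XY by (auto simp: mod_R_iff)
  obtain a where a: "(X - a \<cdot>\<^sub>m 1\<^sub>m n) ^\<^sub>m n = 0\<^sub>m n n"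
    using R_indecomposable_single_eigenvalue[OF assms] by blast
  have "mat_trace (X - a \<cdot>\<^sub>m 1\<^sub>m n) = 0"
    by (rule mat_trace_nilpotent[OF _ a]) (use X in \<open>simp add: minus_carrier_mat\<close>)
  moreover have "mat_trace (X - a \<cdot>\<^sub>m 1\<^sub>m n) = mat_trace X - of_nat n * a"
    using X by (simp add: mat_trace_def sum_subtractf)
  ultimately have "mat_trace X / of_nat n = a" using assms(2) by (simp add: field_simps)
  then show ?thesis using a by simp
qed

lemma jordan_matrix_single: "jordan_matrix [(m, a)] = jordan_block m a"
  unfolding jordan_matrix_Cons by (intro eq_matI) auto

lemma jordan_block_0_kernel:
  fixes w :: "'a::field vec"
  assumes w: "w \<in> carrier_vec n" and n: "n > 0" and ker: "jordan_block n 0 *\<^sub>v w = 0\<^sub>v n"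
  shows "w = w $ 0 \<cdot>\<^sub>v unit_vec n 0"
proof (rule eq_vecI)
  fix i assume "i < dim_vec (w $ 0 \<cdot>\<^sub>v unit_vec n 0)"
  then have i: "i < n" by simp
  show "w $ i = (w $ 0 \<cdot>\<^sub>v unit_vec n 0) $ i"
  proof (cases i)
    case 0
    then show ?thesis using n by simp
  next
    case (Suc j)
    then have j: "j < n" using i by simp
    have "(jordan_block n 0 *\<^sub>v w) $ j = (\<Sum>k\<in>{0..<n}. jordan_block n 0 $$ (j, k) * w $ k)"
      using w j by (simp add: scalar_prod_def)
    also have "\<dots> = (\<Sum>k\<in>{0..<n}. if k = Suc j then w $ k else 0)"
      by (rule sum.cong[OF refl]) (use j in auto)
    also have "\<dots> = w $ i" using i Suc by simp
    finally show ?thesis using ker i j Suc by simp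
  qed
qed (use w in simp)

text \<open>Apply \<open>Y\<close> to a nonzero vector of the submodule and stop just before reaching zero.\<close>

lemma submodule_meets_kernel:
  fixes Y :: "'k::field mat"
  assumes Y: "Y \<in> carrier_mat n n" and nil: "Y ^\<^sub>m N = 0\<^sub>m n n"
    and W: "R_submodule n (X, Y) W" "W \<noteq> {0\<^sub>v n}"
  shows "\<exists>w\<in>W. w \<noteq> 0\<^sub>v n \<and> Y *\<^sub>v w = 0\<^sub>v n"
proof -
  obtain w where w: "w \<in> W" "w \<noteq> 0\<^sub>v n" using W unfolding R_submodule_iff by blast
  have wc: "w \<in> carrier_vec n" using w W unfolding R_submodule_iff by blast
  have step: "Y ^\<^sub>m Suc k *\<^sub>v w = Y *\<^sub>v (Y ^\<^sub>m k *\<^sub>v w)" for k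
    unfolding pow_mat_Suc_left[OF Y] using Y wc by (intro assoc_mult_mat_vec) auto
  have mem: "Y ^\<^sub>m k *\<^sub>v w \<in> W" for k
  proof (induction k)
    case 0
    then show ?case using Y w wc by simp
  next
    case (Suc k)
    then show ?case unfolding step using W(1) unfolding R_submodule_iff by simp
  qed
  define k where "k = (LEAST k. Y ^\<^sub>m k *\<^sub>v w = 0\<^sub>v n)"
  have "Y ^\<^sub>m N *\<^sub>v w = 0\<^sub>v n" unfolding nil using wc by (intro eq_vecI) auto
  then have k: "Y ^\<^sub>m k *\<^sub>v w = 0\<^sub>v n" unfolding k_def by (rule LeastI)
  have "k \<noteq> 0" using k w wc Y by (intro notI) simp
  then obtain j where j: "k = Suc j" by (cases k) auto
  then have "Y ^\<^sub>m j *\<^sub>v w \<noteq> 0\<^sub>v n" using not_less_Least[of j] unfolding k_def[symmetric] by (metis k_def lessI not_less_Least)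
  then show ?thesis using mem[of j] k step[of j] by (intro bexI[of _ "Y ^\<^sub>m j *\<^sub>v w"]) (auto simp: j)
qed

text \<open>The kernel of a single nilpotent Jordan block is a line, and every nonzero submodule contains a
nonzero vector of it. Hence two nonzero submodules always meet.\<close>

lemma stratum_trivial_indecomposable:
  fixes M :: "'k::{alg_closed_field,field_char_0} mat \<times> 'k mat"
  assumes "M \<in> stratum n [n]" and n: "n \<ge> 1"
  shows "R_indecomposable n M"
proof -
  obtain X Y where M: "M = (X, Y)" by force
  have XY: "(X, Y) \<in> mod_R n" and jnf: "jordan_nf Y [(n, 0)]"
    using assms by (auto simp: stratum_def M)
  have Y: "Y \<in> carrier_mat n n" using XY by (auto simp: mod_R_iff)
  note nil = mod_R_nilpotent[OF XY]
  obtain P Q where PQ: "P \<in> carrier_mat n n" "Q \<in> carrier_mat n n" "P * Q = 1\<^sub>m n" "Q * P = 1\<^sub>m n"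
    "Y = P * jordan_matrix [(n, 0)] * Q"
    using jordan_nf_obtain[OF Y jnf] by blast
  define J where "J = (jordan_block n 0 :: 'k mat)"
  have J: "J \<in> carrier_mat n n" by (simp add: J_def)
  have Y_eq: "Y = P * J * Q" using PQ(5) by (simp only: jordan_matrix_single J_def)
  define u where "u = P *\<^sub>v unit_vec n 0"
  have ker: "\<exists>c. w = c \<cdot>\<^sub>v u" if w: "w \<in> carrier_vec n" "Y *\<^sub>v w = 0\<^sub>v n" for w
  proof -
    have Qw: "Q *\<^sub>v w \<in> carrier_vec n" using PQ w by simp
    have "Q * Y = J * Q"
    proof -
      have "Q * Y = Q * P * (J * Q)" unfolding Y_eq using PQ(1,2) J by (simp add: assoc_mult_mat[of _ n n _ n _ n])
      then show ?thesis unfolding PQ(4) using J PQ(2) by simp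
    qed
    then have "J *\<^sub>v (Q *\<^sub>v w) = (Q * Y) *\<^sub>v w" using J PQ w by simp
    also have "\<dots> = Q *\<^sub>v (Y *\<^sub>v w)" by (rule assoc_mult_mat_vec[OF PQ(2) Y w(1)])
    also have "\<dots> = 0\<^sub>v n" unfolding w(2) using PQ by (intro eq_vecI) auto
    finally have "Q *\<^sub>v w = (Q *\<^sub>v w) $ 0 \<cdot>\<^sub>v unit_vec n 0"
      using jordan_block_0_kernel[OF Qw] n by (simp add: J_def)
    then obtain c where c: "Q *\<^sub>v w = c \<cdot>\<^sub>v unit_vec n 0" by blast
    have "w = (P * Q) *\<^sub>v w" using w PQ by simp
    also have "\<dots> = P *\<^sub>v (Q *\<^sub>v w)" by (rule assoc_mult_mat_vec[OF PQ(1,2) w(1)])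
    also have "\<dots> = c \<cdot>\<^sub>v u" unfolding c u_def using PQ(1) by (intro mult_mat_vec) auto
    finally show ?thesis by blast
  qed
  have "unit_vec n 0 \<noteq> (0\<^sub>v n :: 'k vec)"
  proof
    assume "unit_vec n 0 = (0\<^sub>v n :: 'k vec)"
    then have "unit_vec n 0 $ 0 = (0\<^sub>v n $ 0 :: 'k)" by simp
    then show False using n by simp
  qed
  then have ne: "carrier_vec n \<noteq> {0\<^sub>v n :: 'k vec}" using unit_vec_carrier[of n 0] by blast
  have "\<not> (R_submodule n M W1 \<and> R_submodule n M W2 \<and> W1 \<noteq> {0\<^sub>v n} \<and> W2 \<noteq> {0\<^sub>v n} \<and> W1 \<inter> W2 = {0\<^sub>v n})"
    for W1 W2
  proof (intro notI, elim conjE)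
    assume W: "R_submodule n M W1" "R_submodule n M W2" "W1 \<noteq> {0\<^sub>v n}" "W2 \<noteq> {0\<^sub>v n}"
      and disj: "W1 \<inter> W2 = {0\<^sub>v n}"
    obtain w1 where w1: "w1 \<in> W1" "w1 \<noteq> 0\<^sub>v n" "Y *\<^sub>v w1 = 0\<^sub>v n"
      using submodule_meets_kernel[OF Y nil] W unfolding M by blast
    obtain w2 where w2: "w2 \<in> W2" "w2 \<noteq> 0\<^sub>v n" "Y *\<^sub>v w2 = 0\<^sub>v n"
      using submodule_meets_kernel[OF Y nil] W unfolding M by blast
    have c: "w1 \<in> carrier_vec n" "w2 \<in> carrier_vec n" using w1 w2 W unfolding R_submodule_iff by auto
    obtain c1 c2 where cc: "w1 = c1 \<cdot>\<^sub>v u" "w2 = c2 \<cdot>\<^sub>v u" using ker c w1 w2 by metis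
    have u: "u \<in> carrier_vec n" using PQ by (simp add: u_def)
    have "c2 \<cdot>\<^sub>v w1 \<in> W1" "c1 \<cdot>\<^sub>v w2 \<in> W2" using w1 w2 W unfolding R_submodule_iff by auto
    moreover have "c2 \<cdot>\<^sub>v w1 = c1 \<cdot>\<^sub>v w2" unfolding cc by (simp add: smult_smult_assoc mult.commute)
    ultimately have "c2 \<cdot>\<^sub>v w1 = 0\<^sub>v n" using disj by auto
    moreover have "c2 \<noteq> 0" using w2(2) u unfolding cc by auto
    then have "w1 = inverse c2 \<cdot>\<^sub>v (c2 \<cdot>\<^sub>v w1)" by (simp add: smult_smult_assoc)
    moreover have "inverse c2 \<cdot>\<^sub>v 0\<^sub>v n = (0\<^sub>v n :: 'k vec)" by (intro eq_vecI) auto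
    ultimately have "w1 = 0\<^sub>v n" by simp
    with w1(2) show False by simp
  qed
  then show ?thesis unfolding R_indecomposable_def using ne by blast
qed

section \<open>Strata are irreducible\<close>

text \<open>One common denominator \<open>d\<close> suffices for the curves below, where it is the determinant of the
conjugating matrix.\<close>

definition rational_curve :: "'k::field poly mat \<Rightarrow> 'k poly mat \<Rightarrow> 'k poly \<Rightarrow> 'k \<Rightarrow> 'k mat \<times> 'k mat" where
  "rational_curve M N d t =
    (inverse (poly d t) \<cdot>\<^sub>m map_mat (\<lambda>p. poly p t) M, inverse (poly d t) \<cdot>\<^sub>m map_mat (\<lambda>p. poly p t) N)"

text \<open>Clearing denominators turns a polynomial function along the curve into a polynomial in the
parameter.\<close>

lemma poly_function_on_rational_curve:
  assumes "f \<in> poly_functions n" and M: "M \<in> carrier_mat n n" and N: "N \<in> carrier_mat n n"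
  shows "\<exists>p m. \<forall>t. poly d t \<noteq> 0 \<longrightarrow> f (rational_curve M N d t) * poly d t ^ m = poly p t"
  using assms(1)
proof induction
  case (const c)
  show ?case by (intro exI[of _ "[:c:]"] exI[of _ 0]) simp
next
  case (coord_fst i j)
  then show ?case using M
    by (intro exI[of _ "M $$ (i, j)"] exI[of _ 1]) (simp add: rational_curve_def)
next
  case (coord_snd i j)
  then show ?case using N
    by (intro exI[of _ "N $$ (i, j)"] exI[of _ 1]) (simp add: rational_curve_def)
next
  case (add f g)
  then obtain p m q l where
    "\<forall>t. poly d t \<noteq> 0 \<longrightarrow> f (rational_curve M N d t) * poly d t ^ m = poly p t"
    "\<forall>t. poly d t \<noteq> 0 \<longrightarrow> g (rational_curve M N d t) * poly d t ^ l = poly q t" by blast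
  then have "\<forall>t. poly d t \<noteq> 0 \<longrightarrow>
      (f (rational_curve M N d t) + g (rational_curve M N d t)) * poly d t ^ (m + l) =
      poly (p * d ^ l + q * d ^ m) t"
    by (auto simp: power_add algebra_simps)
  then show ?case by blast
next
  case (mult f g)
  then obtain p m q l where
    "\<forall>t. poly d t \<noteq> 0 \<longrightarrow> f (rational_curve M N d t) * poly d t ^ m = poly p t"
    "\<forall>t. poly d t \<noteq> 0 \<longrightarrow> g (rational_curve M N d t) * poly d t ^ l = poly q t" by blast
  then have "\<forall>t. poly d t \<noteq> 0 \<longrightarrow>
      (f (rational_curve M N d t) * g (rational_curve M N d t)) * poly d t ^ (m + l) = poly (p * q) t"
  proof (intro allI impI, elim allE impE)
    fix t
    let ?c = "rational_curve M N d t"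
    assume fg: "f ?c * poly d t ^ m = poly p t" "g ?c * poly d t ^ l = poly q t"
    have "f ?c * g ?c * poly d t ^ (m + l) = (f ?c * poly d t ^ m) * (g ?c * poly d t ^ l)"
      by (simp add: power_add mult_ac)
    then show "f ?c * g ?c * poly d t ^ (m + l) = poly (p * q) t" unfolding fg poly_mult .
  qed
  then show ?case by blast
qed

text \<open>If \<open>f\<close> is nonzero at one end of the curve and \<open>g\<close> at the other, both restrict to nonzero
polynomials in the parameter, and over an infinite field these have a common non-root \<open>t\<close> with
\<open>d(t) \<noteq> 0\<close>. So two proper closed subsets cannot cover the set.\<close>

lemma irreducible_if_joined_by_rational_curves:
  fixes S :: "('k::field_char_0 mat \<times> 'k mat) set"
  assumes S: "S \<subseteq> matrix_pairs n" "S \<noteq> {}"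
    and curves: "\<And>a b. a \<in> S \<Longrightarrow> b \<in> S \<Longrightarrow>
      \<exists>M\<in>carrier_mat n n. \<exists>N\<in>carrier_mat n n. \<exists>d. poly d 0 \<noteq> 0 \<and> poly d 1 \<noteq> 0 \<and>
        rational_curve M N d 0 = a \<and> rational_curve M N d 1 = b \<and>
        (\<forall>t. poly d t \<noteq> 0 \<longrightarrow> rational_curve M N d t \<in> S)"
  shows "irreducible_space (subtopology (zariski n) S)"
proof -
  have top: "S \<subseteq> topspace (zariski n)" using S(1) by (simp add: topspace_zariski)
  have "S \<subseteq> A \<or> S \<subseteq> B" if cl: "closedin (zariski n) A" "closedin (zariski n) B" and sub: "S \<subseteq> A \<union> B" for A B
  proof (rule ccontr)
    assume "\<not> (S \<subseteq> A \<or> S \<subseteq> B)"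
    then obtain a b where a: "a \<in> S" "a \<notin> A" and b: "b \<in> S" "b \<notin> B" by blast
    obtain F G where F: "F \<subseteq> poly_functions n" "A = zero_locus n F"
      and G: "G \<subseteq> poly_functions n" "B = zero_locus n G"
      using cl unfolding closedin_zariski by blast
    obtain f where f: "f \<in> F" "f a \<noteq> 0" using a S(1) unfolding F(2) zero_locus_def by blast
    obtain g where g: "g \<in> G" "g b \<noteq> 0" using b S(1) unfolding G(2) zero_locus_def by blast
    obtain M N d where MN: "M \<in> carrier_mat n n" "N \<in> carrier_mat n n"
      and d: "poly d 0 \<noteq> 0" "poly d 1 \<noteq> 0"
      and ends: "rational_curve M N d 0 = a" "rational_curve M N d 1 = b"
      and inS: "\<And>t. poly d t \<noteq> 0 \<Longrightarrow> rational_curve M N d t \<in> S"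
      using curves[OF a(1) b(1)] by blast
    obtain p m where p: "\<And>t. poly d t \<noteq> 0 \<Longrightarrow> f (rational_curve M N d t) * poly d t ^ m = poly p t"
      using poly_function_on_rational_curve[OF _ MN, of f d] f(1) F(1) by blast
    obtain q l where q: "\<And>t. poly d t \<noteq> 0 \<Longrightarrow> g (rational_curve M N d t) * poly d t ^ l = poly q t"
      using poly_function_on_rational_curve[OF _ MN, of g d] g(1) G(1) by blast
    have "poly p 0 \<noteq> 0" "poly q 1 \<noteq> 0"
      using p[OF d(1)] q[OF d(2)] f(2) g(2) d unfolding ends by (metis mult_eq_0_iff power_not_zero)+
    then have "d * p * q \<noteq> 0" using d(1) by auto
    then have "finite {t. poly (d * p * q) t = 0}" by (rule poly_roots_finite)
    then obtain t where "poly (d * p * q) t \<noteq> 0"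
      using infinite_UNIV_char_0[where ?'a = 'k] by (metis (mono_tags, lifting) UNIV_I finite_subset mem_Collect_eq subsetI)
    then have t: "poly d t \<noteq> 0" "poly p t \<noteq> 0" "poly q t \<noteq> 0" by auto
    let ?c = "rational_curve M N d t"
    have "f ?c \<noteq> 0" "g ?c \<noteq> 0" using p[OF t(1)] q[OF t(1)] t by auto
    then have "?c \<notin> A \<union> B" using f(1) g(1) unfolding F(2) G(2) zero_locus_def by auto
    with inS[OF t(1)] sub show False by blast
  qed
  then show ?thesis unfolding irreducible_subtopology_iff[OF top] using S(2) by blast
qed

lemma stratum_conjugate:
  fixes A :: "'k::field mat"
  assumes "(A, nilpotent_jordan ps) \<in> mod_R n" and "0 \<notin> set ps"
    and P: "P \<in> carrier_mat n n" and Q: "Q \<in> carrier_mat n n" and "P * Q = 1\<^sub>m n" "Q * P = 1\<^sub>m n"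
  shows "(P * A * Q, P * nilpotent_jordan ps * Q) \<in> stratum n ps"
proof -
  have J: "(nilpotent_jordan ps :: 'k mat) \<in> carrier_mat n n" using assms(1) by (simp add: mod_R_iff)
  have "similar_mat (P * nilpotent_jordan ps * Q) (nilpotent_jordan ps)"
    using P Q J assms(5,6) by (intro similar_matI[of _ _ P Q n]) auto
  then have "jordan_nf (P * nilpotent_jordan ps * Q) (map (\<lambda>m. (m, 0)) ps)"
    using assms(2) by (auto simp: jordan_nf_def)
  then show ?thesis using mod_R_conjugate[OF assms(1) P Q assms(6)] by (simp add: stratum_def)
qed

lemma stratum_obtain:
  assumes "M \<in> stratum n ps"
  obtains A P Q where "(A, nilpotent_jordan ps) \<in> mod_R n" "P \<in> carrier_mat n n" "Q \<in> carrier_mat n n"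
    "P * Q = 1\<^sub>m n" "Q * P = 1\<^sub>m n" "M = (P * A * Q, P * nilpotent_jordan ps * Q)"
proof -
  obtain X Y where M: "M = (X, Y)" by force
  have XY: "(X, Y) \<in> mod_R n" and jnf: "jordan_nf Y (map (\<lambda>m. (m, 0)) ps)"
    using assms by (auto simp: stratum_def M)
  have X: "X \<in> carrier_mat n n" and Y: "Y \<in> carrier_mat n n" using XY by (auto simp: mod_R_iff)
  obtain P Q where w: "similar_mat_wit Y (nilpotent_jordan ps) P Q"
    using jnf unfolding jordan_nf_def similar_mat_def by auto
  note D = similar_mat_witD2[OF Y w]
  have "Q * Y * P = nilpotent_jordan ps" unfolding D(3) by (rule conjugate_inverse[OF D(7,6,2,5)])
  then have "(Q * X * P, nilpotent_jordan ps) \<in> mod_R n"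
    using mod_R_conjugate[OF XY D(7,6,1)] by simp
  moreover have "X = P * (Q * X * P) * Q" by (rule conjugate_inverse[symmetric, OF D(6,7,1) X])
  ultimately show thesis using that[of "Q * X * P" P Q] D M by simp
qed

lemma mod_R_line:
  assumes "(A, Y) \<in> mod_R n" "(A', Y) \<in> mod_R n"
  shows "(A + t \<cdot>\<^sub>m (A' - A), Y) \<in> mod_R n"
proof -
  have A: "A \<in> carrier_mat n n" and A': "A' \<in> carrier_mat n n" and Y: "Y \<in> carrier_mat n n"
    and e: "A * Y = Y * A + Y * Y" "A' * Y = Y * A' + Y * Y"
    using assms by (auto simp: mod_R_iff)
  have D: "A' - A \<in> carrier_mat n n" using A by (rule minus_carrier_mat)
  have l: "(A + t \<cdot>\<^sub>m (A' - A)) * Y = A * Y + t \<cdot>\<^sub>m (A' * Y - A * Y)"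
    unfolding minus_mult_distrib_mat[OF A' A Y, symmetric] mult_smult_assoc_mat[OF D Y, symmetric]
    by (rule add_mult_distrib_mat[OF A smult_carrier_mat[OF D] Y])
  have r: "Y * (A + t \<cdot>\<^sub>m (A' - A)) = Y * A + t \<cdot>\<^sub>m (Y * A' - Y * A)"
    unfolding mult_minus_distrib_mat[OF Y A' A, symmetric] mult_smult_distrib[OF Y D, symmetric]
    by (rule mult_add_distrib_mat[OF Y A smult_carrier_mat[OF D]])
  have "U + Z + t \<cdot>\<^sub>m (U' + Z - (U + Z)) = U + t \<cdot>\<^sub>m (U' - U) + Z"
    if "U \<in> carrier_mat n n" "U' \<in> carrier_mat n n" "Z \<in> carrier_mat n n" for U U' Z :: "'a mat"
    using that by (intro eq_matI) auto
  from this[OF mult_carrier_mat[OF Y A] mult_carrier_mat[OF Y A'] mult_carrier_mat[OF Y Y]]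
  have "(A + t \<cdot>\<^sub>m (A' - A)) * Y = Y * (A + t \<cdot>\<^sub>m (A' - A)) + Y * Y"
    unfolding l r e .
  then show ?thesis using A Y D by (simp add: mod_R_iff)
qed

text \<open>The line from \<open>A\<close> to \<open>B\<close> as one matrix over the polynomial ring, so that its determinant and its
adjugate are again polynomial in the parameter.\<close>

definition line_mat :: "nat \<Rightarrow> 'k::field mat \<Rightarrow> 'k mat \<Rightarrow> 'k poly mat" where
  "line_mat n A B = mat n n (\<lambda>(i, j). [:A $$ (i, j), B $$ (i, j) - A $$ (i, j):])"

lemma line_mat_carrier: "line_mat n A B \<in> carrier_mat n n"
  by (simp add: line_mat_def)

lemma eval_line_mat:
  assumes "A \<in> carrier_mat n n" "B \<in> carrier_mat n n"
  shows "map_mat (\<lambda>p. poly p t) (line_mat n A B) = A + t \<cdot>\<^sub>m (B - A)"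
  using assms by (intro eq_matI) (auto simp: line_mat_def algebra_simps)

lemma eval_line_mat_ends:
  assumes "A \<in> carrier_mat n n" "B \<in> carrier_mat n n"
  shows "map_mat (\<lambda>p. poly p 0) (line_mat n A B) = A" "map_mat (\<lambda>p. poly p 1) (line_mat n A B) = B"
  unfolding eval_line_mat[OF assms] using assms by (auto intro!: eq_matI)

text \<open>Two points are given by conjugating matrices \<open>P\<close>, \<open>P'\<close> and solutions \<open>A\<close>, \<open>A'\<close> over the same Jordan matrix.
Both pairs are joined by lines \<open>L\<close>, \<open>B\<close>. The conjugate of \<open>B(t)\<close> by \<open>L(t)\<close> is a
rational curve, since the inverse of \<open>L(t)\<close> is the adjugate over the determinant; wherever the
determinant is nonzero the curve stays in the stratum, because the relation is affine in \<open>X\<close> for fixed \<open>Y\<close>.\<close>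

lemma stratum_irreducible:
  fixes ps :: "nat list"
  assumes "sum_list ps = n" and pos: "0 \<notin> set ps"
  shows "irreducible_space (subtopology (zariski n) (stratum n ps :: ('k::field_char_0 mat \<times> 'k mat) set))"
proof (rule irreducible_if_joined_by_rational_curves)
  show "stratum n ps \<subseteq> (matrix_pairs n :: ('k mat \<times> 'k mat) set)"
    by (auto simp: stratum_def mod_R_def matrix_pairs_def)
  obtain A :: "'k mat" where "(A, nilpotent_jordan ps) \<in> mod_R n"
    using mod_R_nilpotent_jordan_exists[of ps] assms(1) by blast
  then have "(1\<^sub>m n * A * 1\<^sub>m n, 1\<^sub>m n * nilpotent_jordan ps * 1\<^sub>m n) \<in> stratum n ps"
    by (rule stratum_conjugate[OF _ pos]) auto
  then show "stratum n ps \<noteq> ({} :: ('k mat \<times> 'k mat) set)" by blast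
next
  fix a b :: "'k mat \<times> 'k mat"
  assume a: "a \<in> stratum n ps" and b: "b \<in> stratum n ps"
  let ?J = "nilpotent_jordan ps :: 'k mat"
  obtain A P Q where A: "(A, ?J) \<in> mod_R n" and P: "P \<in> carrier_mat n n" and Q: "Q \<in> carrier_mat n n"
    and PQ: "P * Q = 1\<^sub>m n" "Q * P = 1\<^sub>m n" and a_eq: "a = (P * A * Q, P * ?J * Q)"
    by (rule stratum_obtain[OF a])
  obtain A' P' Q' where A': "(A', ?J) \<in> mod_R n" and P': "P' \<in> carrier_mat n n" and Q': "Q' \<in> carrier_mat n n"
    and PQ': "P' * Q' = 1\<^sub>m n" "Q' * P' = 1\<^sub>m n" and b_eq: "b = (P' * A' * Q', P' * ?J * Q')"
    by (rule stratum_obtain[OF b])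
  have Ac: "A \<in> carrier_mat n n" "A' \<in> carrier_mat n n" and J: "?J \<in> carrier_mat n n"
    using A A' by (auto simp: mod_R_iff)
  define L where "L = line_mat n P P'"
  define B where "B = line_mat n A A'"
  define C where "C = line_mat n ?J ?J"
  \<comment> \<open>the adjugate is formed over the polynomial ring, so its entries are polynomials in the parameter\<close>
  define R where "R = adj_mat L"
  define d where "d = det L"
  have L: "L \<in> carrier_mat n n" and B: "B \<in> carrier_mat n n" and C: "C \<in> carrier_mat n n"
    unfolding L_def B_def C_def by (rule line_mat_carrier)+
  note adj = adj_mat[OF L, folded R_def d_def]
  let ?ev = "\<lambda>t. map_mat (\<lambda>p. poly p t)"
  have hom: "comm_ring_hom (\<lambda>p. poly p t)" for t :: 'k by unfold_locales auto
  have semihom: "semiring_hom (\<lambda>p. poly p t)" for t :: 'k by unfold_locales auto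
  have ev_mult: "?ev t (U * V) = ?ev t U * ?ev t V"
    if "U \<in> carrier_mat n n" "V \<in> carrier_mat n n" for t :: 'k and U V
    by (rule semiring_hom.mat_hom_mult[OF semihom that])
  have det_ev: "poly d t = det (?ev t L)" for t
    unfolding d_def by (rule comm_ring_hom.hom_det[symmetric, OF hom])
  have inv: "inverse (poly d t) \<cdot>\<^sub>m ?ev t R \<in> carrier_mat n n"
    "?ev t L * (inverse (poly d t) \<cdot>\<^sub>m ?ev t R) = 1\<^sub>m n"
    "(inverse (poly d t) \<cdot>\<^sub>m ?ev t R) * ?ev t L = 1\<^sub>m n" if "poly d t \<noteq> 0" for t
  proof -
    have c: "?ev t L \<in> carrier_mat n n" "?ev t R \<in> carrier_mat n n" using L adj(1) by auto
    have s: "?ev t (d \<cdot>\<^sub>m 1\<^sub>m n) = poly d t \<cdot>\<^sub>m 1\<^sub>m n" by (intro eq_matI) auto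
    have i: "inverse (poly d t) \<cdot>\<^sub>m (poly d t \<cdot>\<^sub>m 1\<^sub>m n) = 1\<^sub>m n" using that by (intro eq_matI) auto
    show "inverse (poly d t) \<cdot>\<^sub>m ?ev t R \<in> carrier_mat n n" using c by simp
    show "?ev t L * (inverse (poly d t) \<cdot>\<^sub>m ?ev t R) = 1\<^sub>m n"
      unfolding mult_smult_distrib[OF c] ev_mult[OF L adj(1), symmetric] adj(2) s i ..
    show "(inverse (poly d t) \<cdot>\<^sub>m ?ev t R) * ?ev t L = 1\<^sub>m n"
      unfolding mult_smult_assoc_mat[OF c(2,1)] ev_mult[OF adj(1) L, symmetric] adj(3) s i ..
  qed
  have curve: "rational_curve (L * B * R) (L * C * R) d t =
      (?ev t L * ?ev t B * (inverse (poly d t) \<cdot>\<^sub>m ?ev t R),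
       ?ev t L * ?ev t C * (inverse (poly d t) \<cdot>\<^sub>m ?ev t R))" for t
  proof -
    have "?ev t (L * U * R) = ?ev t L * ?ev t U * ?ev t R" if "U \<in> carrier_mat n n" for U
      unfolding ev_mult[OF mult_carrier_mat[OF L that] adj(1)] ev_mult[OF L that] ..
    moreover have "c \<cdot>\<^sub>m (?ev t L * ?ev t U * ?ev t R) = ?ev t L * ?ev t U * (c \<cdot>\<^sub>m ?ev t R)"
      if "U \<in> carrier_mat n n" for U c
      by (rule mult_smult_distrib[symmetric, of _ n n _ n]) (use L that adj(1) in auto)
    ultimately show ?thesis unfolding rational_curve_def using B C by simp
  qed
  have evC: "?ev t C = ?J" for t unfolding C_def eval_line_mat[OF J J] using J by (intro eq_matI) auto
  have ends: "?ev 0 L = P" "?ev 1 L = P'" "?ev 0 B = A" "?ev 1 B = A'"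
    unfolding L_def B_def using eval_line_mat_ends P P' Ac by blast+
  have det_ne: "det U \<noteq> 0" if "U \<in> carrier_mat n n" "V \<in> carrier_mat n n" "U * V = 1\<^sub>m n" for U V :: "'k mat"
    using det_mult[OF that(1,2)] that(3) by auto
  have d01: "poly d 0 \<noteq> 0" "poly d 1 \<noteq> 0"
    unfolding det_ev ends using det_ne P Q PQ P' Q' PQ' by blast+
  have uniq: "V = V'" if "U \<in> carrier_mat n n" "V \<in> carrier_mat n n" "V' \<in> carrier_mat n n"
    "V * U = 1\<^sub>m n" "U * V' = 1\<^sub>m n" for U V V' :: "'k mat"
  proof -
    have "V = V * (U * V')" using that by simp
    also have "\<dots> = V * U * V'" by (rule assoc_mult_mat[symmetric, OF that(2,1,3)])
    finally show ?thesis using that by simp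
  qed
  have e0: "inverse (poly d 0) \<cdot>\<^sub>m ?ev 0 R = Q"
    using inv[OF d01(1)] unfolding ends by (intro uniq[OF P _ Q _ PQ(1)])
  have e1: "inverse (poly d 1) \<cdot>\<^sub>m ?ev 1 R = Q'"
    using inv[OF d01(2)] unfolding ends by (intro uniq[OF P' _ Q' _ PQ'(1)])
  have "rational_curve (L * B * R) (L * C * R) d 0 = a" unfolding curve ends evC e0 a_eq ..
  moreover have "rational_curve (L * B * R) (L * C * R) d 1 = b" unfolding curve ends evC e1 b_eq ..
  moreover have "rational_curve (L * B * R) (L * C * R) d t \<in> stratum n ps" if "poly d t \<noteq> 0" for t
  proof -
    have "(?ev t B, ?J) \<in> mod_R n" unfolding B_def eval_line_mat[OF Ac] by (rule mod_R_line[OF A A'])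
    moreover have "?ev t L \<in> carrier_mat n n" using L by simp
    ultimately show ?thesis unfolding curve evC using inv[OF that] pos by (intro stratum_conjugate)
  qed
  moreover have "L * B * R \<in> carrier_mat n n" "L * C * R \<in> carrier_mat n n" using L B C adj(1) by auto
  ultimately show "\<exists>M\<in>carrier_mat n n. \<exists>N\<in>carrier_mat n n. \<exists>d. poly d 0 \<noteq> 0 \<and> poly d 1 \<noteq> 0 \<and>
        rational_curve M N d 0 = a \<and> rational_curve M N d 1 = b \<and>
        (\<forall>t. poly d t \<noteq> 0 \<longrightarrow> rational_curve M N d t \<in> stratum n ps)"
    using d01 by blast
qed

section \<open>The closed condition on indecomposable modules\<close>

lemma closedin_mod_R: "closedin (zariski n) (mod_R n :: ('k::field mat \<times> 'k mat) set)"
proof -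
  have "mod_R n = {p \<in> matrix_pairs n. fst p * snd p - snd p * fst p - snd p ^\<^sub>m 2 = (0\<^sub>m n n :: 'k mat)}"
    (is "_ = ?Z")
  proof (rule Set.set_eqI)
    fix p :: "'k mat \<times> 'k mat"
    obtain X Y where p: "p = (X, Y)" by force
    have "X * Y - Y * X - Y ^\<^sub>m 2 = 0\<^sub>m n n \<longleftrightarrow> X * Y - Y * X = Y ^\<^sub>m 2"
      if "X \<in> carrier_mat n n" "Y \<in> carrier_mat n n"
    proof -
      have "X * Y - Y * X \<in> carrier_mat n n" "Y ^\<^sub>m 2 \<in> carrier_mat n n" using that by (auto intro: minus_carrier_mat)
      then show ?thesis by (simp add: mat_diff_eq_iff[of _ n n])
    qed
    then show "p \<in> mod_R n \<longleftrightarrow> p \<in> ?Z" unfolding p by (auto simp: mod_R_def matrix_pairs_def)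
  qed
  moreover have "closedin (zariski n) ?Z"
    by (intro closedin_zariski_matrix_eq_0 regular_matrix_diff regular_matrix_mult
        regular_matrix_pow regular_matrix_fst regular_matrix_snd)
  ultimately show ?thesis by simp
qed

definition centred_nilpotent_pairs :: "nat \<Rightarrow> ('k::field_char_0 mat \<times> 'k mat) set" where
  "centred_nilpotent_pairs n = {p \<in> matrix_pairs n.
     (fst p - (mat_trace (fst p) / of_nat n) \<cdot>\<^sub>m 1\<^sub>m n) ^\<^sub>m n = 0\<^sub>m n n}"

lemma closedin_centred_nilpotent_pairs:
  "closedin (zariski n) (centred_nilpotent_pairs n :: ('k::field_char_0 mat \<times> 'k mat) set)"
proof -
  have "regular_function n (\<lambda>p :: 'k mat \<times> 'k mat. (\<Sum>i<n. fst p $$ (i, i)) * inverse (of_nat n))"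
    using regular_matrix_fst[of n, where ?'a = 'k]
    by (intro regular_function_mult regular_function_sum regular_function_const) (simp add: regular_matrix_def)
  then have "regular_function n (\<lambda>p :: 'k mat \<times> 'k mat. mat_trace (fst p) / of_nat n)"
    by (rule regular_function_cong) (auto simp: mat_trace_def matrix_pairs_def divide_inverse)
  then show ?thesis unfolding centred_nilpotent_pairs_def
    by (intro closedin_zariski_matrix_eq_0 regular_matrix_pow regular_matrix_diff regular_matrix_fst
        regular_matrix_smult_one)
qed

lemma eigenvector_of_centred_nilpotent:
  fixes X :: "'k::field mat"
  assumes X: "X \<in> carrier_mat n n" and nil: "(X - c \<cdot>\<^sub>m 1\<^sub>m n) ^\<^sub>m k = 0\<^sub>m n n"
    and v: "eigenvector X v e"
  shows "e = c"
proof -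
  have vc: "v \<in> carrier_vec n" "v \<noteq> 0\<^sub>v n" "X *\<^sub>v v = e \<cdot>\<^sub>v v" using X v by (auto simp: eigenvector_def)
  have A: "X - c \<cdot>\<^sub>m 1\<^sub>m n \<in> carrier_mat n n" by (intro minus_carrier_mat) simp
  have "(c \<cdot>\<^sub>m 1\<^sub>m n) *\<^sub>v v = c \<cdot>\<^sub>v v" using vc(1) by (intro eq_vecI) auto
  then have "(X - c \<cdot>\<^sub>m 1\<^sub>m n) *\<^sub>v v = e \<cdot>\<^sub>v v - c \<cdot>\<^sub>v v"
    using minus_mult_distrib_mat_vec[of X n n "c \<cdot>\<^sub>m 1\<^sub>m n" v] X vc by simp
  also have "\<dots> = (e - c) \<cdot>\<^sub>v v" using vc(1) by (intro eq_vecI) (auto simp: algebra_simps)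
  finally have ev: "eigenvector (X - c \<cdot>\<^sub>m 1\<^sub>m n) v (e - c)" using A vc by (simp add: eigenvector_def)
  have "0\<^sub>m n n *\<^sub>v v = 0\<^sub>v n" using vc(1) by (intro eq_vecI) auto
  then have z: "(e - c) ^ k \<cdot>\<^sub>v v = 0\<^sub>v n" using eigenvector_pow[OF A ev, of k] nil by simp
  obtain i where i: "i < n" "v $ i \<noteq> 0" using vc by (metis carrier_vecD eq_vecI index_zero_vec)
  have "((e - c) ^ k \<cdot>\<^sub>v v) $ i = 0" unfolding z using i by simp
  then have "(e - c) ^ k = 0" using i vc by simp
  then show ?thesis by simp
qed

text \<open>Take a direct sum of a module on the first block and a module on the remaining blocks, and add a
scalar to \<open>X\<close> on the second summand so that one of its eigenvalues differs from one on the first.\<close>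

lemma stratum_not_centred_nilpotent:
  assumes n: "sum_list (m # ps) = n" and pos: "0 \<notin> set (m # ps)" and "ps \<noteq> []"
  shows "\<not> stratum n (m # ps) \<subseteq> (centred_nilpotent_pairs n :: ('k::{alg_closed_field,field_char_0} mat \<times> 'k mat) set)"
proof
  let ?l = "sum_list ps"
  assume sub: "stratum n (m # ps) \<subseteq> (centred_nilpotent_pairs n :: ('k mat \<times> 'k mat) set)"
  have m: "m > 0" using pos by simp
  have l: "?l > 0" using assms(3) pos by (cases ps) auto
  obtain A1 :: "'k mat" where A1: "(A1, jordan_block m 0) \<in> mod_R m" using mod_R_jordan_block by blast
  obtain A2 :: "'k mat" where A2: "(A2, nilpotent_jordan ps) \<in> mod_R ?l"
    using mod_R_nilpotent_jordan_exists by blast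
  have A1c: "A1 \<in> carrier_mat m m" and A2c: "A2 \<in> carrier_mat ?l ?l" using A1 A2 by (auto simp: mod_R_iff)
  obtain a v where v: "eigenvector A1 v a" using eigenvalue_exists[OF A1c m] by (auto simp: eigenvalue_def)
  obtain b w where w: "eigenvector A2 w b" using eigenvalue_exists[OF A2c l] by (auto simp: eigenvalue_def)
  have vc: "v \<in> carrier_vec m" "v \<noteq> 0\<^sub>v m" "A1 *\<^sub>v v = a \<cdot>\<^sub>v v" using v A1c by (auto simp: eigenvector_def)
  have wc: "w \<in> carrier_vec ?l" "w \<noteq> 0\<^sub>v ?l" "A2 *\<^sub>v w = b \<cdot>\<^sub>v w" using w A2c by (auto simp: eigenvector_def)
  \<comment> \<open>the shift moves the eigenvalue \<open>b\<close> of the second summand to \<open>a + 1\<close>\<close>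
  define c where "c = a - b + 1"
  define B where "B = A2 + c \<cdot>\<^sub>m 1\<^sub>m ?l"
  have Bc: "B \<in> carrier_mat ?l ?l" using A2c by (simp add: B_def)
  have "(c \<cdot>\<^sub>m 1\<^sub>m ?l) *\<^sub>v w = c \<cdot>\<^sub>v w" using wc(1) by (intro eq_vecI) auto
  then have "B *\<^sub>v w = b \<cdot>\<^sub>v w + c \<cdot>\<^sub>v w"
    unfolding B_def using add_mult_distrib_mat_vec[of A2 ?l ?l "c \<cdot>\<^sub>m 1\<^sub>m ?l" w] A2c wc by simp
  also have "\<dots> = (a + 1) \<cdot>\<^sub>v w" using wc(1) by (intro eq_vecI) (auto simp: c_def algebra_simps)
  finally have Bw: "B *\<^sub>v w = (a + 1) \<cdot>\<^sub>v w" .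
  define X where "X = four_block_mat A1 (0\<^sub>m m ?l) (0\<^sub>m ?l m) B"
  have mn: "m + ?l = n" using n by simp
  have Xc: "X \<in> carrier_mat n n" unfolding X_def mn[symmetric] by (rule four_block_carrier_mat[OF A1c Bc])
  have XJ: "(X, nilpotent_jordan (m # ps)) \<in> mod_R n"
    unfolding X_def B_def nilpotent_jordan_Cons mn[symmetric]
    by (rule mod_R_four_block[OF A1 mod_R_add_scalar[OF A2]])
  then have Jc: "(nilpotent_jordan (m # ps) :: 'k mat) \<in> carrier_mat n n" by (simp only: mod_R_iff)
  have "jordan_nf (nilpotent_jordan (m # ps) :: 'k mat) (map (\<lambda>m. (m, 0)) (m # ps))"
    using similar_mat_refl[OF Jc] pos unfolding jordan_nf_def by auto
  then have "(X, nilpotent_jordan (m # ps)) \<in> stratum n (m # ps)"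
    using XJ unfolding stratum_def by blast
  then have nil: "(X - (mat_trace X / of_nat n) \<cdot>\<^sub>m 1\<^sub>m n) ^\<^sub>m n = 0\<^sub>m n n"
    using sub unfolding centred_nilpotent_pairs_def by auto
  have zl: "A1 *\<^sub>v 0\<^sub>v m = 0\<^sub>v m" "B *\<^sub>v 0\<^sub>v ?l = 0\<^sub>v ?l" using A1c Bc by (auto intro!: eq_vecI)
  have "X *\<^sub>v (v @\<^sub>v 0\<^sub>v ?l) = (a \<cdot>\<^sub>v v) @\<^sub>v 0\<^sub>v ?l"
    unfolding X_def using mult_mat_vec_split[OF A1c Bc vc(1), of "0\<^sub>v ?l"] vc zl by simp
  also have "\<dots> = a \<cdot>\<^sub>v (v @\<^sub>v 0\<^sub>v ?l)" using vc(1) by (intro eq_vecI) auto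
  finally have e1: "X *\<^sub>v (v @\<^sub>v 0\<^sub>v ?l) = a \<cdot>\<^sub>v (v @\<^sub>v 0\<^sub>v ?l)" .
  have "X *\<^sub>v (0\<^sub>v m @\<^sub>v w) = 0\<^sub>v m @\<^sub>v ((a + 1) \<cdot>\<^sub>v w)"
    unfolding X_def using mult_mat_vec_split[OF A1c Bc _ wc(1), of "0\<^sub>v m"] Bw zl by simp
  also have "\<dots> = (a + 1) \<cdot>\<^sub>v (0\<^sub>v m @\<^sub>v w)" using wc(1) by (intro eq_vecI) auto
  finally have e2: "X *\<^sub>v (0\<^sub>v m @\<^sub>v w) = (a + 1) \<cdot>\<^sub>v (0\<^sub>v m @\<^sub>v w)" .
  have "(0\<^sub>v n :: 'k vec) = 0\<^sub>v m @\<^sub>v 0\<^sub>v ?l" unfolding mn[symmetric] by (intro eq_vecI) auto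
  then have ne: "v @\<^sub>v 0\<^sub>v ?l \<noteq> 0\<^sub>v n" "0\<^sub>v m @\<^sub>v w \<noteq> 0\<^sub>v n"
    using vc wc append_vec_eq[of v m "0\<^sub>v m" "0\<^sub>v ?l" "0\<^sub>v ?l"]
      append_vec_eq[of "0\<^sub>v m" m "0\<^sub>v m" w "0\<^sub>v ?l"] by auto
  have "v @\<^sub>v 0\<^sub>v ?l \<in> carrier_vec n" "0\<^sub>v m @\<^sub>v w \<in> carrier_vec n"
    unfolding mn[symmetric] using vc(1) wc(1) by auto
  then have ev: "eigenvector X (v @\<^sub>v 0\<^sub>v ?l) a" "eigenvector X (0\<^sub>v m @\<^sub>v w) (a + 1)"
    using Xc e1 e2 ne unfolding eigenvector_def by auto
  have "a = a + 1"
    unfolding eigenvector_of_centred_nilpotent[OF Xc nil ev(2)]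
    by (rule eigenvector_of_centred_nilpotent[OF Xc nil ev(1)])
  then show False by simp
qed

section \<open>Irreducible components\<close>

lemma stratum_subset_mod_R: "stratum n ps \<subseteq> mod_R n"
  by (auto simp: stratum_def)

lemma mod_R_subset_topspace: "mod_R n \<subseteq> topspace (zariski n)"
  unfolding topspace_zariski by (auto simp: mod_R_def matrix_pairs_def)

lemma stratum_closure_subset_mod_R: "stratum_closure n ps \<subseteq> mod_R n"
  unfolding stratum_closure_def by (rule closure_of_minimal[OF stratum_subset_mod_R closedin_mod_R])

lemma subtopology_mod_R_variety:
  "C \<subseteq> mod_R n \<Longrightarrow> subtopology (mod_R_variety n) C = subtopology (zariski n) C"
  by (simp add: mod_R_variety_def subtopology_subtopology Int_absorb1)

lemma topspace_mod_R_variety: "topspace (mod_R_variety n) = mod_R n"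
  using mod_R_subset_topspace[of n] by (auto simp: mod_R_variety_def topspace_subtopology)

lemma irreducible_components_mod_R_iff:
  fixes C :: "('k::field mat \<times> 'k mat) set"
  shows "C \<in> irreducible_components_of (mod_R_variety n) \<longleftrightarrow>
     C \<subseteq> mod_R n \<and> irreducible_space (subtopology (zariski n) C) \<and>
     (\<forall>D. D \<subseteq> mod_R n \<and> irreducible_space (subtopology (zariski n) D) \<and> C \<subseteq> D \<longrightarrow> D = C)"
proof -
  have "subtopology (mod_R_variety n) D = subtopology (zariski n) D"
    if "D \<subseteq> mod_R n" for D :: "('k mat \<times> 'k mat) set"
    by (rule subtopology_mod_R_variety[OF that])
  then show ?thesis
    unfolding irreducible_components_of_def topspace_mod_R_variety mem_Collect_eq by (metis (no_types, lifting))
qed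

lemma finite_partitions: "finite {ps :: nat list. sum_list ps = n \<and> 0 \<notin> set ps}"
proof (rule finite_subset)
  show "finite {xs. set xs \<subseteq> {..n} \<and> length xs \<le> n}" by (rule finite_lists_length_le) simp
  have "length ps \<le> sum_list ps" if "0 \<notin> set ps" for ps :: "nat list"
    using that by (induction ps) auto
  then show "{ps. sum_list ps = n \<and> 0 \<notin> set ps} \<subseteq> {xs. set xs \<subseteq> {..n} \<and> length xs \<le> n}"
    using member_le_sum_list by fastforce
qed

lemma stratum_closure_irreducible:
  assumes "sum_list ps = n" "0 \<notin> set ps"
  shows "irreducible_space (subtopology (zariski n)
    (stratum_closure n ps :: ('k::field_char_0 mat \<times> 'k mat) set))"
  unfolding stratum_closure_def
  using stratum_subset_mod_R mod_R_subset_topspace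
  by (intro irreducible_closure_of stratum_irreducible assms) blast

text \<open>The component is covered by the finitely many closures of strata, so it lies in one of them, and
that closure is irreducible.\<close>

lemma irreducible_component_is_stratum_closure:
  fixes C :: "('k::{alg_closed_field,field_char_0} mat \<times> 'k mat) set"
  assumes "C \<in> irreducible_components_of (mod_R_variety n)"
  obtains ps where "sum_list ps = n" "0 \<notin> set ps" "C = stratum_closure n ps"
proof -
  let ?Ps = "{ps :: nat list. sum_list ps = n \<and> 0 \<notin> set ps}"
  have C: "C \<subseteq> mod_R n" "irreducible_space (subtopology (zariski n) C)"
    and max: "\<And>D. D \<subseteq> mod_R n \<Longrightarrow> irreducible_space (subtopology (zariski n) D) \<Longrightarrow> C \<subseteq> D \<Longrightarrow> D = C"
    using assms unfolding irreducible_components_mod_R_iff by blast+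
  have top: "stratum n ps \<subseteq> topspace (zariski n)" for ps
    using stratum_subset_mod_R mod_R_subset_topspace by blast
  have "C \<subseteq> \<Union>(stratum_closure n ` ?Ps)"
  proof
    fix p assume "p \<in> C"
    obtain X Y where p: "p = (X, Y)" by force
    have XY: "(X, Y) \<in> mod_R n" using \<open>p \<in> C\<close> C(1) p by blast
    obtain ps where "jordan_nf Y (map (\<lambda>m. (m, 0)) ps)" "sum_list ps = n" "0 \<notin> set ps"
      by (rule mod_R_jordan_nf[OF XY])
    then have "p \<in> stratum n ps" "ps \<in> ?Ps" using XY by (auto simp: stratum_def p)
    then show "p \<in> \<Union>(stratum_closure n ` ?Ps)"
      using closure_of_subset[OF top] unfolding stratum_closure_def by blast
  qed
  moreover have "C \<subseteq> topspace (zariski n)" using C(1) mod_R_subset_topspace by blast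
  ultimately have "\<exists>F\<in>stratum_closure n ` ?Ps. C \<subseteq> F"
    using finite_partitions C(2)
    by (intro irreducible_subset_finite_Union[where T = "zariski n"])
      (auto simp: stratum_closure_def)
  then obtain ps where ps: "sum_list ps = n" "0 \<notin> set ps" "C \<subseteq> stratum_closure n ps" by auto
  have "stratum_closure n ps = C"
    by (rule max[OF stratum_closure_subset_mod_R stratum_closure_irreducible[OF ps(1,2)] ps(3)])
  with ps show thesis using that by blast
qed

lemma stratum_trivial_eq:
  assumes n: "n \<ge> 1"
  shows "stratum n [n] = mod_R n \<inter>
    {p \<in> matrix_pairs n. snd p ^\<^sub>m (n - 1) \<noteq> (0\<^sub>m n n :: 'k::{alg_closed_field,field_char_0} mat)}"
proof (rule Set.set_eqI)
  fix p :: "'k mat \<times> 'k mat"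
  obtain X Y where p: "p = (X, Y)" by force
  have "jordan_nf Y [(n, 0)] \<longleftrightarrow> Y ^\<^sub>m (n - 1) \<noteq> 0\<^sub>m n n" if XY: "(X, Y) \<in> mod_R n"
  proof
    have Y: "Y \<in> carrier_mat n n" using XY by (simp add: mod_R_iff)
    assume jnf: "jordan_nf Y [(n, 0)]"
    then obtain P Q where "similar_mat_wit Y (jordan_block n 0) P Q"
      unfolding jordan_nf_def jordan_matrix_single similar_mat_def by auto
    from similar_mat_wit_sym[OF this] have w: "similar_mat_wit (jordan_block n 0) Y Q P" .
    have D: "P \<in> carrier_mat n n" "Q \<in> carrier_mat n n"
      using similar_mat_witD2[OF jordan_block_carrier w] by auto
    show "Y ^\<^sub>m (n - 1) \<noteq> 0\<^sub>m n n"
    proof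
      assume "Y ^\<^sub>m (n - 1) = 0\<^sub>m n n"
      then have "jordan_block n 0 ^\<^sub>m (n - 1) = (0\<^sub>m n n :: 'k mat)"
        using similar_mat_wit_pow_id[OF w, of "n - 1"] D by simp
      moreover have "(jordan_block n 0 ^\<^sub>m (n - 1)) $$ (0, n - 1) = (1 :: 'k)"
        unfolding jordan_block_zero_pow using n by simp
      ultimately show False using n by simp
    qed
  next
    have Y: "Y \<in> carrier_mat n n" using XY by (simp add: mod_R_iff)
    assume ne: "Y ^\<^sub>m (n - 1) \<noteq> 0\<^sub>m n n"
    obtain ps where ps: "jordan_nf Y (map (\<lambda>m. (m, 0)) ps)" "sum_list ps = n" "0 \<notin> set ps"
      by (rule mod_R_jordan_nf[OF XY])
    have "\<not> (\<forall>m\<in>set ps. m \<le> n - 1)" using jordan_nf_nilpotent_pow_eq_0[OF Y ps(1)] ne by blast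
    then obtain m where m: "m \<in> set ps" "m \<ge> n" by force
    then obtain as bs where as: "ps = as @ m # bs" by (meson split_list)
    then have "sum_list as = 0" "sum_list bs = 0" "m = n" using ps(2) m(2) by auto
    then have "as = []" "bs = []" using ps(3) unfolding as by (cases as; cases bs; auto)+
    then show "jordan_nf Y [(n, 0)]" using ps(1) \<open>m = n\<close> by (simp add: as)
  qed
  then show "p \<in> stratum n [n] \<longleftrightarrow> p \<in> mod_R n \<inter> {p \<in> matrix_pairs n. snd p ^\<^sub>m (n - 1) \<noteq> 0\<^sub>m n n}"
    unfolding p stratum_def by (auto simp: mod_R_iff matrix_pairs_def)
qed

lemma openin_nonzero_power:
  "openin (zariski n) {p \<in> matrix_pairs n. snd p ^\<^sub>m k \<noteq> (0\<^sub>m n n :: 'k::field mat)}"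
proof -
  have "closedin (zariski n) {p \<in> matrix_pairs n. snd p ^\<^sub>m k = (0\<^sub>m n n :: 'k mat)}"
    by (intro closedin_zariski_matrix_eq_0 regular_matrix_pow regular_matrix_snd)
  then have "openin (zariski n) (topspace (zariski n) - {p \<in> matrix_pairs n. snd p ^\<^sub>m k = (0\<^sub>m n n :: 'k mat)})"
    by blast
  also have "topspace (zariski n) - {p \<in> matrix_pairs n. snd p ^\<^sub>m k = (0\<^sub>m n n :: 'k mat)} =
      {p \<in> matrix_pairs n. snd p ^\<^sub>m k \<noteq> 0\<^sub>m n n}"
    unfolding topspace_zariski by blast
  finally show ?thesis .
qed

text \<open>The stratum is open in the variety, so it is dense in every irreducible subset that contains it.\<close>

lemma stratum_closure_trivial_is_component:
  assumes n: "n \<ge> 1"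
  shows "(stratum_closure n [n] :: ('k::{alg_closed_field,field_char_0} mat \<times> 'k mat) set)
    \<in> irreducible_components_of (mod_R_variety n)"
  unfolding irreducible_components_mod_R_iff
proof (intro conjI allI impI; (elim conjE)?)
  let ?S = "stratum n [n] :: ('k mat \<times> 'k mat) set"
  let ?K = "stratum_closure n [n] :: ('k mat \<times> 'k mat) set"
  let ?W = "{p \<in> matrix_pairs n. snd p ^\<^sub>m (n - 1) \<noteq> (0\<^sub>m n n :: 'k mat)}"
  have SK: "?S \<subseteq> ?K" unfolding stratum_closure_def
    using stratum_subset_mod_R mod_R_subset_topspace by (intro closure_of_subset) blast
  show "?K \<subseteq> mod_R n" by (rule stratum_closure_subset_mod_R)
  show "irreducible_space (subtopology (zariski n) ?K)"
    using n by (intro stratum_closure_irreducible) auto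
  fix D assume D: "D \<subseteq> mod_R n" "irreducible_space (subtopology (zariski n) D)" "?K \<subseteq> D"
  have DW: "D \<inter> ?W = ?S" using D(1,3) SK unfolding stratum_trivial_eq[OF n] by blast
  have top: "?S \<subseteq> topspace (zariski n)" using stratum_subset_mod_R mod_R_subset_topspace by blast
  have "irreducible_space (subtopology (zariski n) ?S)" using n by (intro stratum_irreducible) auto
  then have "?S \<noteq> {}" using irreducible_subtopology_iff[OF top] by blast
  then have ne: "D \<inter> ?W \<noteq> {}" unfolding DW .
  have Dtop: "D \<subseteq> topspace (zariski n)" using D(1) mod_R_subset_topspace by blast
  have "D \<subseteq> zariski n closure_of (D \<inter> ?W)"
    by (rule irreducible_subset_closure_of_open[OF Dtop D(2) openin_nonzero_power ne])
  then show "D = ?K" using D(3) unfolding DW stratum_closure_def by blast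
qed

theorem mainTheorem2:
  fixes n :: nat
  assumes "n \<ge> 1"
  shows "{C \<in> irreducible_components_of
                (mod_R_variety n :: ('k::{alg_closed_field,field_char_0} mat \<times> 'k mat) topology).
            \<exists>U. openin (subtopology (mod_R_variety n) C) U \<and>
                (subtopology (mod_R_variety n) C) closure_of U = C \<and>
                (\<forall>M\<in>U. R_indecomposable n M)}
         = {stratum_closure n [n]}"
proof (intro equalityI subsetI)
  fix C :: "('k mat \<times> 'k mat) set"
  assume "C \<in> {C \<in> irreducible_components_of (mod_R_variety n).
            \<exists>U. openin (subtopology (mod_R_variety n) C) U \<and>
                (subtopology (mod_R_variety n) C) closure_of U = C \<and> (\<forall>M\<in>U. R_indecomposable n M)}"
  then obtain U where C: "C \<in> irreducible_components_of (mod_R_variety n)"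
    and U: "openin (subtopology (mod_R_variety n) C) U" "(subtopology (mod_R_variety n) C) closure_of U = C"
    and ind: "\<And>M. M \<in> U \<Longrightarrow> R_indecomposable n M" by blast
  have CR: "C \<subseteq> mod_R n" using C by (simp add: irreducible_components_mod_R_iff)
  have UC: "U \<subseteq> C" using openin_subset[OF U(1)] by (auto simp: topspace_subtopology)
  obtain ps where ps: "sum_list ps = n" "0 \<notin> set ps" "C = stratum_closure n ps"
    by (rule irreducible_component_is_stratum_closure[OF C])
  have "U \<subseteq> centred_nilpotent_pairs n"
  proof
    fix M assume "M \<in> U"
    obtain X Y where M: "M = (X, Y)" by force
    have "(X, Y) \<in> mod_R n" "R_indecomposable n (X, Y)" using \<open>M \<in> U\<close> ind UC CR M by auto
    then show "M \<in> centred_nilpotent_pairs n"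
      using R_indecomposable_centred_nilpotent[OF _ assms] 
      by (auto simp: M centred_nilpotent_pairs_def matrix_pairs_def mod_R_iff)
  qed
  then have "zariski n closure_of U \<subseteq> centred_nilpotent_pairs n"
    by (rule closure_of_minimal[OF _ closedin_centred_nilpotent_pairs])
  moreover have "C \<subseteq> zariski n closure_of U"
    using U(2) UC unfolding subtopology_mod_R_variety[OF CR] closure_of_subtopology
    by (metis Int_absorb1 Int_lower2)
  moreover have "stratum n ps \<subseteq> C"
    unfolding ps(3) stratum_closure_def using stratum_subset_mod_R mod_R_subset_topspace
    by (intro closure_of_subset) blast
  ultimately have sub: "stratum n ps \<subseteq> (centred_nilpotent_pairs n :: ('k mat \<times> 'k mat) set)" by blast
  have "ps = [n]"
  proof (cases ps)
    case Nil
    then show ?thesis using ps(1) assms by simp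
  next
    case (Cons m qs)
    have "qs = []"
      using stratum_not_centred_nilpotent[of m qs n, where ?'k = 'k] ps(1,2) sub unfolding Cons by blast
    then show ?thesis using ps(1) Cons by simp
  qed
  then show "C \<in> {stratum_closure n [n]}" using ps(3) by simp
next
  fix C :: "('k mat \<times> 'k mat) set"
  assume "C \<in> {stratum_closure n [n]}"
  then have C: "C = stratum_closure n [n]" by simp
  let ?S = "stratum n [n] :: ('k mat \<times> 'k mat) set"
  have CR: "C \<subseteq> mod_R n" unfolding C by (rule stratum_closure_subset_mod_R)
  have SC: "?S \<subseteq> C" unfolding C stratum_closure_def
    using stratum_subset_mod_R mod_R_subset_topspace by (intro closure_of_subset) blast
  have "?S = {p \<in> matrix_pairs n. snd p ^\<^sub>m (n - 1) \<noteq> (0\<^sub>m n n :: 'k mat)} \<inter> C"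
    using SC CR unfolding stratum_trivial_eq[OF assms] by blast
  then have "openin (subtopology (mod_R_variety n) C) ?S"
    unfolding subtopology_mod_R_variety[OF CR] openin_subtopology
    using openin_nonzero_power by blast
  moreover have "(subtopology (mod_R_variety n) C) closure_of ?S = C"
    unfolding subtopology_mod_R_variety[OF CR] closure_of_subtopology Int_absorb1[OF SC]
    by (simp add: C stratum_closure_def)
  moreover have "\<forall>M\<in>?S. R_indecomposable n M"
    using stratum_trivial_indecomposable assms by blast
  moreover have "C \<in> irreducible_components_of (mod_R_variety n)"
    unfolding C by (rule stratum_closure_trivial_is_component[OF assms])
  ultimately show "C \<in> {C \<in> irreducible_components_of (mod_R_variety n).
            \<exists>U. openin (subtopology (mod_R_variety n) C) U \<and>
                (subtopology (mod_R_variety n) C) closure_of U = C \<and> (\<forall>M\<in>U. R_indecomposable n M)}"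
    by blast
qed

end
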